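(* In the Delsarte-dual setting of the context, let $T$ be an $\mathbb{F}_{q^m}$-subspace of $\mathbb{V}(k,q^m)$ with $\langle T\cap U\rangle_{\mathbb{F}_{q^m}}=T$ and $\varepsilon_U(T)>0$. If $T$ is minimal with respect to its defect (with respect to $U$), then (1) $w_{U^d}(T^d)=n-w_U(T)$; (2) $\varepsilon_{U^d}(T^d)=k-\dim_{\mathbb{F}_{q^m}}(T)$; (3) $(T^d)^d=T$. Moreover, $T^d$ is minimal with respect to its defect (with respect to $U^d$).
   Context: Let $q$ be a prime power, $m$ a positive integer, $1\le k<n$. Let $\mathbb{V}(n,q^m)$ be an $n$-dimensional $\mathbb{F}_{q^m}$-space and $W$ an $n$-dimensional $\mathbb{F}_q$-subspace with $\langle W\rangle_{\mathbb{F}_{q^m}}=\mathbb{V}(n,q^m)$. For $S\subseteq W$ an $\mathbb{F}_q$-subspace, $S^*=\langle S\rangle_{\mathbb{F}_{q^m}}$. Let $\sigma'$ be a non-degenerate reflexive $\mathbb{F}_q$-bilinear form on $W$ and $\sigma$ its $\mathbb{F}_{q^m}$-bilinear extension; $\perp$ is orthogonal complement w.r.t. $\sigma$. Let $\Gamma$ be an $(n-k)$-dimensional $\mathbb{F}_{q^m}$-subspace with $\Gamma\cap W=\{0\}$; $\mathbb{V}(k,q^m)=\mathbb{V}(n,q^m)/\Gamma$, $U=(W+\Gamma)/\Gamma$, $\mathbb{V}(n-k,q^m)=\mathbb{V}(n,q^m)/\Gamma^\perp$, $U^d=(W+\Gamma^\perp)/\Gamma^\perp$. Weight $w_U(T)=\dim_{\mathbb{F}_q}(U\cap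 T)$, defect $\varepsilon_U(T)=w_U(T)-\dim_{\mathbb{F}_{q^m}}T$; $T$ is minimal with respect to its defect if every proper $\mathbb{F}_{q^m}$-subspace $T'$ of $T$ has $\varepsilon_U(T')<\varepsilon_U(T)$. For $T\subseteq\mathbb{V}(k,q^m)$ with $\langle T\cap U\rangle=T$, let $S=\{w\in W:w+\Gamma\in T\}$ and $T^d=((S^* )^\perp+\Gamma^\perp)/\Gamma^\perp$; for $X\subseteq\mathbb{V}(n-k,q^m)$ with $\langle X\cap U^d\rangle=X$, let $R=\{w\in W: w+\Gamma^\perp\in X\}$ and $X^d=((R^* )^\perp+\Gamma)/\Gamma$.
   Formalization: The formal theorem additionally assumes Γ^⊥ ∩ W = {0}; without it (1) fails, e.g. q=2, m=2, n=3, k=2, W=F_2^3 with the dot product, Γ=⟨(1,ω,0)⟩, T the image of ⟨e1,e2⟩, where T^d=0. In general (1) holds exactly when Γ^⊥ ∩ W = {0}. *)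

theory Defs
  imports
    "HOL-Number_Theory.Prime_Powers"
    "Jordan_Normal_Form.Missing_VectorSpace"
    "HOL-Algebra.AbelCoset"
    "HOL-Algebra.Subrings"
begin

text \<open>
  Vector spaces are the carrier-based ones of the locale \<open>vectorspace\<close>. If \<open>F\<close> is a subfield of
  \<open>K\<close>, the underlying \<open>F\<close>-space of a \<open>K\<close>-space \<open>V\<close> is the same record \<open>V\<close>, regarded over the
  scalar ring \<open>K\<lparr>carrier := F\<rparr>\<close>. A subspace is a set of vectors; it is turned into a space of its
  own (in order to speak of its dimension) by overwriting the carrier.
\<close>

abbreviation dim_over ::
  "('a, 'k) ring_scheme \<Rightarrow> ('a, 'v, 'm) module_scheme \<Rightarrow> 'v set \<Rightarrow> nat" where
  "dim_over K V S \<equiv> vectorspace.dim K (V\<lparr>carrier := S\<rparr>)"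


subsection \<open>Quotient spaces\<close>

text \<open>The fields \<open>mult\<close> and \<open>one\<close> of a module record play no role for modules.\<close>

definition quot_space ::
  "('a, 'v, 'm) module_scheme \<Rightarrow> 'v set \<Rightarrow> ('a, 'v set) module" where
  "quot_space V N =
     \<lparr>carrier = a_rcosets\<^bsub>V\<^esub> N, monoid.mult = undefined, one = undefined, zero = N, add = set_add V,
      smult = (\<lambda>a X. \<Union>v\<in>X. N +>\<^bsub>V\<^esub> (a \<odot>\<^bsub>V\<^esub> v))\<rparr>"

lemma quot_space_simps [simp]:
  "carrier (quot_space V N) = a_rcosets\<^bsub>V\<^esub> N"
  "\<zero>\<^bsub>quot_space V N\<^esub> = N"
  "X \<oplus>\<^bsub>quot_space V N\<^esub> Y = X <+>\<^bsub>V\<^esub> Y"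
  "a \<odot>\<^bsub>quot_space V N\<^esub> X = (\<Union>v\<in>X. N +>\<^bsub>V\<^esub> (a \<odot>\<^bsub>V\<^esub> v))"
  by (simp_all add: quot_space_def)

lemma submodule_abelian_subgroup:
  assumes "submodule K N V"
  shows "abelian_subgroup N V"
proof -
  interpret S: submodule K N V by fact
  interpret Module.module K V by (rule S.module)
  show ?thesis
  proof (rule abelian_subgroupI3)
    show "abelian_group V" by (rule M.abelian_group_axioms)
    show "additive_subgroup N V"
    proof (rule additive_subgroupI, rule M.add.subgroupI)
      show "N \<subseteq> carrier V" by (rule S.subset)
      show "N \<noteq> {}" using S.zero_closed by blast
      fix a b assume a: "a \<in> N" and b: "b \<in> N"
      have "(\<ominus>\<^bsub>K\<^esub> \<one>\<^bsub>K\<^esub>) \<odot>\<^bsub>V\<^esub> a \<in> N" using a by (intro S.smult_closed) auto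
      moreover have "(\<ominus>\<^bsub>K\<^esub> \<one>\<^bsub>K\<^esub>) \<odot>\<^bsub>V\<^esub> a = \<ominus>\<^bsub>V\<^esub> a"
        using a S.subset by (subst smult_l_minus) auto
      ultimately show "\<ominus>\<^bsub>V\<^esub> a \<in> N" by simp
      show "a \<oplus>\<^bsub>V\<^esub> b \<in> N" using a b by (rule S.m_closed)
    qed
  qed
qed

lemma quot_space_smult_coset:
  assumes "submodule K N V" and a: "a \<in> carrier K" and v: "v \<in> carrier V"
  shows "a \<odot>\<^bsub>quot_space V N\<^esub> (N +>\<^bsub>V\<^esub> v) = N +>\<^bsub>V\<^esub> (a \<odot>\<^bsub>V\<^esub> v)"
proof -
  interpret S: submodule K N V by fact
  interpret Module.module K V by (rule S.module)
  interpret N: abelian_subgroup N V using assms(1) by (rule submodule_abelian_subgroup)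
  have *: "N +>\<^bsub>V\<^esub> (a \<odot>\<^bsub>V\<^esub> u) = N +>\<^bsub>V\<^esub> (a \<odot>\<^bsub>V\<^esub> v)" if "u \<in> N +>\<^bsub>V\<^esub> v" for u
  proof -
    from that obtain h where h: "h \<in> N" "u = h \<oplus>\<^bsub>V\<^esub> v" unfolding a_r_coset_def' by auto
    have hV: "h \<in> carrier V" using h S.subset by auto
    have "a \<odot>\<^bsub>V\<^esub> u = a \<odot>\<^bsub>V\<^esub> h \<oplus>\<^bsub>V\<^esub> a \<odot>\<^bsub>V\<^esub> v"
      using a v hV h by (simp add: smult_r_distr)
    then have "a \<odot>\<^bsub>V\<^esub> u \<in> N +>\<^bsub>V\<^esub> (a \<odot>\<^bsub>V\<^esub> v)"
      using S.smult_closed[OF a h(1)] unfolding a_r_coset_def' by auto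
    then show ?thesis using a v by (intro N.a_repr_independence'[symmetric]) auto
  qed
  have "a \<odot>\<^bsub>quot_space V N\<^esub> (N +>\<^bsub>V\<^esub> v) = (\<Union>u\<in>N +>\<^bsub>V\<^esub> v. N +>\<^bsub>V\<^esub> (a \<odot>\<^bsub>V\<^esub> v))"
    unfolding quot_space_simps by (rule SUP_cong[OF refl *])
  also have "\<dots> = N +>\<^bsub>V\<^esub> (a \<odot>\<^bsub>V\<^esub> v)"
    using N.a_rcos_self[OF v] by (intro SUP_eq_const) (blast, rule refl)
  finally show ?thesis .
qed

lemma module_quot_space:
  assumes sub: "submodule K N V"
  shows "Module.module K (quot_space V N)"
proof -
  interpret S: submodule K N V by fact
  interpret Module.module K V by (rule S.module)
  interpret N: abelian_subgroup N V using sub by (rule submodule_abelian_subgroup)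
  note module_smult = Module.module.smult_closed[OF S.module]
  note smult = quot_space_smult_coset[OF sub]
  interpret G: comm_group "V A_Mod N" by (rule N.a_factorgroup_is_comm_group)
  have G: "carrier (V A_Mod N) = carrier (quot_space V N)" "\<one>\<^bsub>V A_Mod N\<^esub> = \<zero>\<^bsub>quot_space V N\<^esub>"
    "X \<otimes>\<^bsub>V A_Mod N\<^esub> Y = X \<oplus>\<^bsub>quot_space V N\<^esub> Y" for X Y
    by (simp_all add: A_FactGroup_def' A_RCOSETS_def set_add_def)
  have ag: "abelian_group (quot_space V N)"
    by (rule abelian_groupI)
       (fact G.m_closed[unfolded G] G.one_closed[unfolded G] G.m_assoc[unfolded G]
         G.m_comm[unfolded G] G.l_one[unfolded G] G.l_inv_ex[unfolded G])+
  have ex: "\<exists>v\<in>carrier V. X = N +>\<^bsub>V\<^esub> v" if "X \<in> carrier (quot_space V N)" for X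
    using that by (auto simp: A_RCOSETS_def')
  have add: "(N +>\<^bsub>V\<^esub> u) \<oplus>\<^bsub>quot_space V N\<^esub> (N +>\<^bsub>V\<^esub> v) = N +>\<^bsub>V\<^esub> (u \<oplus>\<^bsub>V\<^esub> v)"
    if "u \<in> carrier V" "v \<in> carrier V" for u v
    using that by (simp add: N.a_rcos_sum)
  show ?thesis
  proof (rule moduleI)
    show "cring K" by (rule R.is_cring)
    show "abelian_group (quot_space V N)" by (rule ag)
  next
    fix a X assume a: "a \<in> carrier K" and "X \<in> carrier (quot_space V N)"
    then obtain v where v: "v \<in> carrier V" "X = N +>\<^bsub>V\<^esub> v" using ex by blast
    have "N +>\<^bsub>V\<^esub> (a \<odot>\<^bsub>V\<^esub> v) \<in> a_rcosets\<^bsub>V\<^esub> N"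
      using a v(1) by (intro M.a_rcosetsI S.subset module_smult)
    then show "a \<odot>\<^bsub>quot_space V N\<^esub> X \<in> carrier (quot_space V N)"
      unfolding v(2) smult[OF a v(1)] by (simp only: quot_space_simps)
  next
    fix a b X assume a: "a \<in> carrier K" and b: "b \<in> carrier K"
      and "X \<in> carrier (quot_space V N)"
    then obtain v where v: "v \<in> carrier V" "X = N +>\<^bsub>V\<^esub> v" using ex by blast
    show "(a \<oplus>\<^bsub>K\<^esub> b) \<odot>\<^bsub>quot_space V N\<^esub> X = a \<odot>\<^bsub>quot_space V N\<^esub> X \<oplus>\<^bsub>quot_space V N\<^esub> b \<odot>\<^bsub>quot_space V N\<^esub> X"
      unfolding v(2) smult[OF a v(1)] smult[OF b v(1)] smult[OF R.a_closed[OF a b] v(1)]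
        add[OF module_smult[OF a v(1)] module_smult[OF b v(1)]]
      by (simp only: smult_l_distr[OF a b v(1)])
  next
    fix a X Y assume a: "a \<in> carrier K"
      and "X \<in> carrier (quot_space V N)" "Y \<in> carrier (quot_space V N)"
    then obtain u v where u: "u \<in> carrier V" "X = N +>\<^bsub>V\<^esub> u"
      and v: "v \<in> carrier V" "Y = N +>\<^bsub>V\<^esub> v" using ex by blast
    show "a \<odot>\<^bsub>quot_space V N\<^esub> (X \<oplus>\<^bsub>quot_space V N\<^esub> Y) = a \<odot>\<^bsub>quot_space V N\<^esub> X \<oplus>\<^bsub>quot_space V N\<^esub> a \<odot>\<^bsub>quot_space V N\<^esub> Y"
      unfolding u(2) v(2) add[OF u(1) v(1)] smult[OF a u(1)] smult[OF a v(1)]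
        smult[OF a M.a_closed[OF u(1) v(1)]]
        add[OF module_smult[OF a u(1)] module_smult[OF a v(1)]]
      by (simp only: smult_r_distr[OF a u(1) v(1)])
  next
    fix a b X assume a: "a \<in> carrier K" and b: "b \<in> carrier K"
      and "X \<in> carrier (quot_space V N)"
    then obtain v where v: "v \<in> carrier V" "X = N +>\<^bsub>V\<^esub> v" using ex by blast
    show "(a \<otimes>\<^bsub>K\<^esub> b) \<odot>\<^bsub>quot_space V N\<^esub> X = a \<odot>\<^bsub>quot_space V N\<^esub> (b \<odot>\<^bsub>quot_space V N\<^esub> X)"
      unfolding v(2) smult[OF b v(1)] smult[OF a module_smult[OF b v(1)]]
        smult[OF R.m_closed[OF a b] v(1)]
      by (simp only: smult_assoc1[OF a b v(1)])
  next
    fix X assume "X \<in> carrier (quot_space V N)"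
    then obtain v where v: "v \<in> carrier V" "X = N +>\<^bsub>V\<^esub> v" using ex by blast
    show "\<one>\<^bsub>K\<^esub> \<odot>\<^bsub>quot_space V N\<^esub> X = X"
      unfolding v(2) smult[OF R.one_closed v(1)] by (simp only: smult_one[OF v(1)])
  qed
qed

lemma vectorspace_quot_space:
  assumes "VectorSpace.subspace K N V"
  shows "vectorspace K (quot_space V N)"
  using assms module_quot_space[of K N V]
  unfolding VectorSpace.subspace_def vectorspace_def by blast

lemma vectorspace_subfield:
  assumes "vectorspace K V" and "subfield F K"
  shows "vectorspace (K\<lparr>carrier := F\<rparr>) V"
proof -
  interpret vectorspace K V by fact
  have fld: "field (K\<lparr>carrier := F\<rparr>)" using assms(2) by (rule subfield_iff(2))
  have FK: "F \<subseteq> carrier K" using assms(2) by (simp add: subfieldE(3))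
  have "Module.module (K\<lparr>carrier := F\<rparr>) V"
  proof (rule moduleI)
    show "cring (K\<lparr>carrier := F\<rparr>)" using fld by (simp add: field_def domain_def)
    show "abelian_group V" by (rule M.abelian_group_axioms)
  qed (use FK in \<open>auto simp: smult_l_distr smult_r_distr smult_assoc1 subset_iff\<close>)
  with fld show ?thesis by (simp add: vectorspace_def)
qed

text \<open>The set \<open>(A + N) / N\<close> of cosets.\<close>

definition quot_image ::
  "('a, 'v, 'm) module_scheme \<Rightarrow> 'v set \<Rightarrow> 'v set \<Rightarrow> 'v set set" where
  "quot_image V N A = (\<lambda>v. N +>\<^bsub>V\<^esub> v) ` (A <+>\<^bsub>V\<^esub> N)"


subsection \<open>Bilinear forms\<close>

definition bilinear_form ::
  "('a, 'k) ring_scheme \<Rightarrow> ('a, 'v, 'm) module_scheme \<Rightarrow> ('v \<Rightarrow> 'v \<Rightarrow> 'a) \<Rightarrow> bool" where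
  "bilinear_form K V b \<longleftrightarrow>
     (\<forall>x\<in>carrier V. \<forall>y\<in>carrier V. b x y \<in> carrier K) \<and>
     (\<forall>x\<in>carrier V. \<forall>y\<in>carrier V. \<forall>z\<in>carrier V.
        b (x \<oplus>\<^bsub>V\<^esub> y) z = b x z \<oplus>\<^bsub>K\<^esub> b y z \<and> b z (x \<oplus>\<^bsub>V\<^esub> y) = b z x \<oplus>\<^bsub>K\<^esub> b z y) \<and>
     (\<forall>a\<in>carrier K. \<forall>x\<in>carrier V. \<forall>y\<in>carrier V.
        b (a \<odot>\<^bsub>V\<^esub> x) y = a \<otimes>\<^bsub>K\<^esub> b x y \<and> b x (a \<odot>\<^bsub>V\<^esub> y) = a \<otimes>\<^bsub>K\<^esub> b x y)"

definition reflexive_form ::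
  "('a, 'k) ring_scheme \<Rightarrow> ('a, 'v, 'm) module_scheme \<Rightarrow> ('v \<Rightarrow> 'v \<Rightarrow> 'a) \<Rightarrow> bool" where
  "reflexive_form K V b \<longleftrightarrow>
     (\<forall>x\<in>carrier V. \<forall>y\<in>carrier V. b x y = \<zero>\<^bsub>K\<^esub> \<longrightarrow> b y x = \<zero>\<^bsub>K\<^esub>)"

definition nondegenerate_form ::
  "('a, 'k) ring_scheme \<Rightarrow> ('a, 'v, 'm) module_scheme \<Rightarrow> ('v \<Rightarrow> 'v \<Rightarrow> 'a) \<Rightarrow> bool" where
  "nondegenerate_form K V b \<longleftrightarrow>
     (\<forall>x\<in>carrier V. (\<forall>y\<in>carrier V. b x y = \<zero>\<^bsub>K\<^esub>) \<longrightarrow> x = \<zero>\<^bsub>V\<^esub>) \<and>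
     (\<forall>x\<in>carrier V. (\<forall>y\<in>carrier V. b y x = \<zero>\<^bsub>K\<^esub>) \<longrightarrow> x = \<zero>\<^bsub>V\<^esub>)"

text \<open>For reflexive forms the left and the right orthogonal complement agree.\<close>

definition orth ::
  "('a, 'k) ring_scheme \<Rightarrow> ('a, 'v, 'm) module_scheme \<Rightarrow> ('v \<Rightarrow> 'v \<Rightarrow> 'a) \<Rightarrow> 'v set \<Rightarrow> 'v set" where
  "orth K V b A = {v \<in> carrier V. \<forall>a\<in>A. b a v = \<zero>\<^bsub>K\<^esub>}"


subsection \<open>Weight and defect\<close>

definition weight ::
  "('a, 'k) ring_scheme \<Rightarrow> 'a set \<Rightarrow> ('a, 'v, 'm) module_scheme \<Rightarrow> 'v set \<Rightarrow> 'v set \<Rightarrow> nat" where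
  "weight K F V U T = dim_over (K\<lparr>carrier := F\<rparr>) V (U \<inter> T)"

definition defect ::
  "('a, 'k) ring_scheme \<Rightarrow> 'a set \<Rightarrow> ('a, 'v, 'm) module_scheme \<Rightarrow> 'v set \<Rightarrow> 'v set \<Rightarrow> int" where
  "defect K F V U T = int (weight K F V U T) - int (dim_over K V T)"

definition minimal_wrt_defect ::
  "('a, 'k) ring_scheme \<Rightarrow> 'a set \<Rightarrow> ('a, 'v, 'm) module_scheme \<Rightarrow> 'v set \<Rightarrow> 'v set \<Rightarrow> bool" where
  "minimal_wrt_defect K F V U T \<longleftrightarrow>
     (\<forall>T'. VectorSpace.subspace K T' V \<and> T' \<subset> T \<longrightarrow> defect K F V U T' < defect K F V U T)"


subsection \<open>The dual of a subspace\<close>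

text \<open>
  \<open>T\<close> is a subspace of \<open>V / N\<close>, and its dual lives in \<open>V / N'\<close>. With \<open>N' = N\<^sup>\<bottom>\<close> this is the map
  \<open>T \<mapsto> T\<^sup>d\<close>; with the roles of \<open>N\<close> and \<open>N\<^sup>\<bottom>\<close> exchanged it is the map in the opposite direction.

  In the duality, \<open>N\<^sup>\<bottom>\<close> is required to meet the \<open>F\<close>-space \<open>W\<close> trivially, just as \<open>N\<close> is; equivalently,
  the dual \<open>(W + N\<^sup>\<bottom>) / N\<^sup>\<bottom>\<close> has the same \<open>F\<close>-dimension as \<open>W\<close>. Otherwise the weight formula for
  dual subspaces is false: take \<open>F = GF(2)\<close>, \<open>K = GF(4) = F(\<omega>)\<close>, \<open>W = F\<^sup>3\<close> with the standard dot
  product, and \<open>N\<close> spanned by \<open>(1, \<omega>, 0)\<close>, so that \<open>(0, 0, 1) \<in> N\<^sup>\<bottom> \<inter> W\<close>. The image \<open>T\<close> of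
  \<open>\<langle>e\<^sub>1, e\<^sub>2\<rangle>\<close> has dimension 1, weight 2 and is minimal with respect to its defect, but its dual is
  zero and hence has weight 0 rather than 3 - 2.
\<close>

definition dual_subspace ::
  "('a, 'k) ring_scheme \<Rightarrow> ('a, 'v, 'm) module_scheme \<Rightarrow> ('v \<Rightarrow> 'v \<Rightarrow> 'a) \<Rightarrow> 'v set \<Rightarrow>
     'v set \<Rightarrow> 'v set \<Rightarrow> 'v set set \<Rightarrow> 'v set set" where
  "dual_subspace K V b W N N' T =
     quot_image V N' (orth K V b (LinearCombinations.module.span K V {w \<in> W. N +>\<^bsub>V\<^esub> w \<in> T}))"

end

theory Submission
  imports Defs
begin

text \<open>
  Let \<open>S\<close> be the preimage of \<open>T\<close> in \<open>W\<close>, let \<open>S\<^sup>*\<close> be its \<open>K\<close>-span and \<open>S' = S\<^sup>\<bottom> \<inter> W\<close>. Independence over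
  \<open>F\<close> and over \<open>K\<close> agree inside \<open>W\<close>, so the defect of \<open>T\<close> is the dimension of \<open>S\<^sup>* \<inter> \<Gamma>\<close>, and
  \<open>S'\<^sup>* = (S\<^sup>*)\<^sup>\<bottom>\<close>. The preimage \<open>R\<close> of \<open>T\<^sup>d\<close> in \<open>W\<close> is \<open>(S\<^sup>* \<inter> \<Gamma>)\<^sup>\<bottom> \<inter> W\<close>. If it were larger than \<open>S'\<close>,
  then \<open>R\<^sup>\<bottom> \<inter> W\<close> would be a proper subspace of \<open>S\<close> whose span still contains \<open>S\<^sup>* \<inter> \<Gamma>\<close>, and its image
  would contradict the minimality of \<open>T\<close>. Hence \<open>R = S'\<close>, and the rest is a dimension count in which
  \<open>S'\<^sup>* \<inter> \<Gamma>\<^sup>\<bottom> = (S\<^sup>* + \<Gamma>)\<^sup>\<bottom>\<close>.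

  Left and right orthogonal complements are kept apart throughout, so that the extension of the form
  to \<open>V\<close> need not be known to be reflexive.
\<close>

section \<open>Subspaces and their images in quotients\<close>

text \<open>A maximal independent subset of \<open>A\<close> is enlarged to a maximal one of
  \<open>B\<close>. Nested bases turn the later comparisons of dimensions into comparisons of finite
  cardinalities.\<close>

lemma (in vectorspace) subspace_basis_extension:
  assumes fd: "fin_dim" and A: "subspace K A V" and B: "subspace K B V" and AB: "A \<subseteq> B"
  obtains C D where "finite D" "C \<subseteq> D" "D \<subseteq> B" "lin_indpt D" "span C = A" "span D = B"
    "card C = dim_over K V A" "card D = dim_over K V B"
proof -
  have submod: "submodule K A V" "submodule K B V" using A B by auto
  have AV: "A \<subseteq> carrier V" and BV: "B \<subseteq> carrier V"
    using submod by (auto dest: submodule.subset)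
  interpret A: vectorspace K "vs A" using A by (rule subspace_is_vs)
  interpret B: vectorspace K "vs B" using B by (rule subspace_is_vs)
  have bound: "finite X \<and> card X \<le> dim" if "X \<subseteq> carrier V \<and> lin_indpt X" for X
    using li_le_dim[OF fd] that by auto
  have "\<exists>C. finite C \<and> maximal C (\<lambda>X. X \<subseteq> A \<and> lin_indpt X)"
    by (rule maximal_exists[where N = dim and B = "{}"])
       (use bound AV in blast, auto simp: lin_dep_def)
  then obtain C where C: "finite C" "maximal C (\<lambda>X. X \<subseteq> A \<and> lin_indpt X)" by auto
  have CA: "C \<subseteq> A" "lin_indpt C" using C(2) by (auto simp: maximal_def)
  have "\<exists>D. finite D \<and> maximal D (\<lambda>X. X \<subseteq> B \<and> lin_indpt X \<and> C \<subseteq> X)"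
    by (rule maximal_exists[where N = dim and B = C])
       (use bound BV in blast, use CA AB in auto)
  then obtain D where D: "finite D" "maximal D (\<lambda>X. X \<subseteq> B \<and> lin_indpt X \<and> C \<subseteq> X)" by auto
  have DB: "D \<subseteq> B" "lin_indpt D" "C \<subseteq> D" using D(2) by (auto simp: maximal_def)
  have li: "A.lin_dep X = lin_dep X" if "X \<subseteq> A" for X
    by (rule span_li_not_depend(2)[OF that submod(1)])
  have li': "B.lin_dep X = lin_dep X" if "X \<subseteq> B" for X
    by (rule span_li_not_depend(2)[OF that submod(2)])
  have "maximal C (\<lambda>X. X \<subseteq> carrier (vs A) \<and> A.lin_indpt X)"
    using C(2) li unfolding maximal_def carrier_vs_is_self by blast
  then have bC: "A.basis C" by (rule A.max_li_is_basis)
  \<comment> \<open>\<open>D\<close> was chosen maximal among sets containing \<open>C\<close>;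
    every superset of \<open>D\<close> contains \<open>C\<close>, so it is maximal among all
    independent subsets of \<open>B\<close>.\<close>
  have "maximal D (\<lambda>X. X \<subseteq> carrier (vs B) \<and> B.lin_indpt X)"
    unfolding maximal_def
  proof (intro conjI allI impI)
    show "D \<subseteq> carrier (vs B)" "B.lin_indpt D" using DB li' by auto
    fix X assume X: "D \<subseteq> X \<and> X \<subseteq> carrier (vs B) \<and> B.lin_indpt X"
    then have "X \<subseteq> B" "lin_indpt X" "C \<subseteq> X" using DB li' by auto
    with X show "X = D" using D(2) unfolding maximal_def by blast
  qed
  then have bD: "B.basis D" by (rule B.max_li_is_basis)
  have "span C = A"
    using bC span_li_not_depend(1)[OF CA(1) submod(1)] by (simp add: A.basis_def)
  moreover have "span D = B"
    using bD span_li_not_depend(1)[OF DB(1) submod(2)] by (simp add: B.basis_def)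
  ultimately show ?thesis
    using that[of D C] A.dim_basis[OF C(1) bC] B.dim_basis[OF D(1) bD] DB D(1) by simp
qed

lemma (in vectorspace) carrier_subspace: "subspace K (carrier V) V"
  by unfold_locales auto

lemma (in vectorspace) subspace_fin_dim:
  assumes "fin_dim" "subspace K A V"
  shows "vectorspace.fin_dim K (vs A)"
proof -
  interpret A: vectorspace K "vs A" using assms(2) by (rule subspace_is_vs)
  obtain C D where D: "finite D" "C \<subseteq> D" "D \<subseteq> A" "lin_indpt D" "span C = A" "span D = A"
    "card C = dim_over K V A" "card D = dim_over K V A"
    by (rule subspace_basis_extension[OF assms(1,2,2) order_refl])
  then show ?thesis
    unfolding A.fin_dim_def using span_li_not_depend(1)[OF D(3) is_module[OF assms(2)]] D(1,3,6)
    by (intro exI[of _ D]) simp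
qed

lemma (in vectorspace) dim_subspace_mono:
  assumes "fin_dim" "subspace K A V" "subspace K B V" "A \<subseteq> B"
  shows "dim_over K V A \<le> dim_over K V B"
proof -
  obtain C D where "finite D" "C \<subseteq> D" "D \<subseteq> B" "lin_indpt D" "span C = A" "span D = B"
    "card C = dim_over K V A" "card D = dim_over K V B"
    by (rule subspace_basis_extension[OF assms])
  then show ?thesis using card_mono[of D C] by simp
qed

text \<open>Nested finite bases coincide once the larger one has no more elements than the
  smaller.\<close>

lemma (in vectorspace) subspace_eqI:
  assumes "fin_dim" "subspace K A V" "subspace K B V" "A \<subseteq> B"
    and "dim_over K V B \<le> dim_over K V A"
  shows "A = B"
proof -
  obtain C D where *: "finite D" "C \<subseteq> D" "D \<subseteq> B" "lin_indpt D" "span C = A" "span D = B"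
    "card C = dim_over K V A" "card D = dim_over K V B"
    by (rule subspace_basis_extension[OF assms(1-4)])
  then have "C = D" using assms(5) by (intro card_seteq) auto
  with * show ?thesis by simp
qed

lemma (in vectorspace) dim_span_le:
  assumes "finite A" "A \<subseteq> carrier V"
  shows "dim_over K V (span A) \<le> card A"
proof -
  have sub: "subspace K (span A) V" by (rule span_is_subspace[OF assms(2)])
  interpret A: vectorspace K "vs (span A)" using sub by (rule subspace_is_vs)
  show ?thesis
    using assms in_own_span[OF assms(2)]
      span_li_not_depend(1)[OF in_own_span[OF assms(2)] is_module[OF sub]]
    by (intro A.gen_ge_dim) auto
qed

lemma (in vectorspace) dim_zero_subspace: "dim_over K V {\<zero>\<^bsub>V\<^esub>} = 0"
  using dim_span_le[of "{}"] by (simp add: span_empty)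

lemma (in vectorspace) subspace_Int:
  assumes "subspace K A V" "subspace K B V"
  shows "subspace K (A \<inter> B) V"
proof -
  interpret A: subspace K A V by fact
  interpret B: subspace K B V by fact
  interpret A: submodule K A V by (rule A.submod)
  interpret B: submodule K B V by (rule B.submod)
  show ?thesis
    by (intro subspace.intro submodule.intro A.vs module_axioms) (use A.subset in auto)
qed

lemma (in vectorspace) subspace_set_add:
  assumes "subspace K A V" "subspace K B V"
  shows "subspace K (A <+>\<^bsub>V\<^esub> B) V"
proof -
  have "A <+>\<^bsub>V\<^esub> B = subspace_sum A B"
    by (force simp: set_add_def' submodule_sum_def)
  then show ?thesis using sum_is_subspace[OF assms] by simp
qed

lemma (in vectorspace) subset_set_add:
  assumes "subspace K A V" "subspace K B V"
  shows "A \<subseteq> A <+>\<^bsub>V\<^esub> B" "B \<subseteq> A <+>\<^bsub>V\<^esub> B"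
proof -
  have s: "submodule K A V" "submodule K B V" using assms by auto
  have z: "\<zero>\<^bsub>V\<^esub> \<in> A" "\<zero>\<^bsub>V\<^esub> \<in> B" and c: "A \<subseteq> carrier V" "B \<subseteq> carrier V"
    using s by (auto dest: submodule.subset submodule.zero_closed)
  show "A \<subseteq> A <+>\<^bsub>V\<^esub> B"
  proof
    fix x assume "x \<in> A"
    then have "x = x \<oplus>\<^bsub>V\<^esub> \<zero>\<^bsub>V\<^esub>" using c by auto
    then show "x \<in> A <+>\<^bsub>V\<^esub> B" using \<open>x \<in> A\<close> z unfolding set_add_def' by blast
  qed
  show "B \<subseteq> A <+>\<^bsub>V\<^esub> B"
  proof
    fix x assume "x \<in> B"
    then have "x = \<zero>\<^bsub>V\<^esub> \<oplus>\<^bsub>V\<^esub> x" using c by auto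
    then show "x \<in> A <+>\<^bsub>V\<^esub> B" using \<open>x \<in> B\<close> z unfolding set_add_def' by blast
  qed
qed

section \<open>Cosets and images in a quotient space\<close>

lemma (in vectorspace) r_coset_eq_iff:
  assumes N: "subspace K N V" and u: "u \<in> carrier V" and v: "v \<in> carrier V"
  shows "N +>\<^bsub>V\<^esub> u = N +>\<^bsub>V\<^esub> v \<longleftrightarrow> u \<ominus>\<^bsub>V\<^esub> v \<in> N"
proof -
  interpret N: abelian_subgroup N V
    by (rule submodule_abelian_subgroup[OF is_module[OF N]])
  show ?thesis
    using N.a_rcos_module[OF v u] N.a_repr_independence'[of u v] N.a_rcos_self[OF u] u v
    by (auto simp: a_minus_def)
qed

lemma (in vectorspace) quot_image_eq_image:
  assumes N: "subspace K N V" and A: "A \<subseteq> carrier V"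
  shows "quot_image V N A = (\<lambda>v. N +>\<^bsub>V\<^esub> v) ` A"
proof -
  interpret S: submodule K N V using N by auto
  have *: "N +>\<^bsub>V\<^esub> (a \<oplus>\<^bsub>V\<^esub> x) = N +>\<^bsub>V\<^esub> a" if "a \<in> A" "x \<in> N" for a x
  proof -
    have c: "a \<in> carrier V" "x \<in> carrier V" using that A S.subset by auto
    then have "a \<oplus>\<^bsub>V\<^esub> x \<ominus>\<^bsub>V\<^esub> a = x"
      by (simp only: M.a_comm[of a x] a_minus_def M.a_assoc M.a_inv_closed M.r_neg M.r_zero)
    then show ?thesis using that c by (simp add: r_coset_eq_iff[OF N])
  qed
  have "N +>\<^bsub>V\<^esub> a \<in> quot_image V N A" if "a \<in> A" for a
  proof -
    have "a \<oplus>\<^bsub>V\<^esub> \<zero>\<^bsub>V\<^esub> \<in> A <+>\<^bsub>V\<^esub> N"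
      using that S.zero_closed unfolding set_add_def' by blast
    then show ?thesis unfolding quot_image_def by (rule rev_image_eqI) (use that A in auto)
  qed
  moreover have "quot_image V N A \<subseteq> (\<lambda>v. N +>\<^bsub>V\<^esub> v) ` A"
    unfolding quot_image_def set_add_def' using * by auto
  ultimately show ?thesis by blast
qed

lemma (in vectorspace) coset_mem_quot_image_iff:
  assumes N: "subspace K N V" and A: "A \<subseteq> carrier V" and v: "v \<in> carrier V"
  shows "N +>\<^bsub>V\<^esub> v \<in> quot_image V N A \<longleftrightarrow> v \<in> A <+>\<^bsub>V\<^esub> N"
proof
  interpret S: submodule K N V using N by auto
  assume "N +>\<^bsub>V\<^esub> v \<in> quot_image V N A"
  then obtain a where a: "a \<in> A" "N +>\<^bsub>V\<^esub> v = N +>\<^bsub>V\<^esub> a"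
    using quot_image_eq_image[OF N A] by auto
  then have "v \<ominus>\<^bsub>V\<^esub> a \<in> N" using A v by (auto simp: r_coset_eq_iff[OF N])
  moreover have "v = a \<oplus>\<^bsub>V\<^esub> (v \<ominus>\<^bsub>V\<^esub> a)"
    using a A v by (simp add: subset_iff a_minus_def M.a_lcomm[of a v] M.r_neg)
  ultimately show "v \<in> A <+>\<^bsub>V\<^esub> N" using a(1) unfolding set_add_def' by blast
qed (simp add: quot_image_def)

lemma (in vectorspace) quot_linear_map:
  assumes N: "subspace K N V" and A: "subspace K A V"
  shows "linear_map K (vs A) (quot_space V N) (\<lambda>v. N +>\<^bsub>V\<^esub> v)"
proof -
  interpret A: vectorspace K "vs A" using A by (rule subspace_is_vs)
  interpret Q: vectorspace K "quot_space V N" using N by (rule vectorspace_quot_space)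
  interpret S: submodule K N V using N by auto
  interpret N: abelian_subgroup N V by (rule submodule_abelian_subgroup[OF is_module[OF N]])
  have AV: "A \<subseteq> carrier V" using submodule.subset[OF is_module[OF A]] .
  show ?thesis
  proof unfold_locales
    show "(+>\<^bsub>V\<^esub>) N \<in> module_hom K (vs A) (quot_space V N)"
      unfolding module_hom_def
      using AV quot_space_smult_coset[OF is_module[OF N]]
      by (auto simp: N.a_rcos_sum subset_iff simp del: quot_space_simps(4)
          intro!: M.a_rcosetsI S.subset)
  qed
qed

lemma (in vectorspace) quot_image_subspace:
  assumes N: "subspace K N V" and A: "subspace K A V"
  shows "subspace K (quot_image V N A) (quot_space V N)"
proof -
  interpret f: linear_map K "vs A" "quot_space V N" "\<lambda>v. N +>\<^bsub>V\<^esub> v"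
    by (rule quot_linear_map[OF N A])
  have AV: "A \<subseteq> carrier V" using submodule.subset[OF is_module[OF A]] .
  show ?thesis
    using f.imT_is_subspace unfolding f.im_def quot_image_eq_image[OF N AV] by simp
qed

text \<open>Rank-nullity for the projection restricted to \<open>A\<close>, whose kernel is
  \<open>A \<inter> N\<close>.\<close>

lemma (in vectorspace) dim_quot_image:
  assumes fd: "fin_dim" and N: "subspace K N V" and A: "subspace K A V"
  shows "dim_over K (quot_space V N) (quot_image V N A) + dim_over K V (A \<inter> N) = dim_over K V A"
proof -
  interpret f: linear_map K "vs A" "quot_space V N" "\<lambda>v. N +>\<^bsub>V\<^esub> v"
    by (rule quot_linear_map[OF N A])
  interpret N: abelian_subgroup N V by (rule submodule_abelian_subgroup[OF is_module[OF N]])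
  have AV: "A \<subseteq> carrier V" using submodule.subset[OF is_module[OF A]] .
  have "N +>\<^bsub>V\<^esub> v = N \<longleftrightarrow> v \<in> N" if "v \<in> A" for v
    using that AV N.a_rcos_const N.a_rcos_self by blast
  then have "f.ker = A \<inter> N" unfolding f.ker_def by auto
  then show ?thesis
    using f.rank_nullity[OF subspace_fin_dim[OF fd A]]
    unfolding f.im_def quot_image_eq_image[OF N AV] by simp
qed

text \<open>\<open>A\<close> and its sum with \<open>N\<close> have the same image, while the kernel
  of the projection on the sum is all of \<open>N\<close>.\<close>

lemma (in vectorspace) dim_set_add:
  assumes fd: "fin_dim" and N: "subspace K N V" and A: "subspace K A V"
  shows "dim_over K V (A <+>\<^bsub>V\<^esub> N) =
    dim_over K (quot_space V N) (quot_image V N A) + dim_over K V N"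
proof -
  let ?B = "A <+>\<^bsub>V\<^esub> N"
  have B: "subspace K ?B V" by (rule subspace_set_add[OF A N])
  have AV: "A \<subseteq> carrier V" using submodule.subset[OF is_module[OF A]] .
  have BV: "?B \<subseteq> carrier V" using submodule.subset[OF is_module[OF B]] .
  have "quot_image V N ?B = quot_image V N A"
    unfolding quot_image_eq_image[OF N BV] unfolding quot_image_def ..
  moreover have "?B \<inter> N = N" using subset_set_add[OF A N] by auto
  ultimately show ?thesis using dim_quot_image[OF fd N B] by simp
qed

section \<open>Orthogonal complements\<close>

locale bilinear_space = vectorspace K V
  for K :: "('a, 'k) ring_scheme" (structure) and V :: "('a, 'v, 'm) module_scheme" +
  fixes b :: "'v \<Rightarrow> 'v \<Rightarrow> 'a"
  assumes finite_dim: "fin_dim" and bilinear: "bilinear_form K V b"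
begin

abbreviation rperp :: "'v set \<Rightarrow> 'v set" where
  "rperp \<equiv> orth K V b"

abbreviation lperp :: "'v set \<Rightarrow> 'v set" where
  "lperp \<equiv> orth K V (\<lambda>x y. b y x)"

lemma form_closed [simp]: "x \<in> carrier V \<Longrightarrow> y \<in> carrier V \<Longrightarrow> b x y \<in> carrier K"
  using bilinear by (simp add: bilinear_form_def)

lemma form_add [simp]:
  assumes "x \<in> carrier V" "y \<in> carrier V" "z \<in> carrier V"
  shows "b (x \<oplus>\<^bsub>V\<^esub> y) z = b x z \<oplus> b y z" "b z (x \<oplus>\<^bsub>V\<^esub> y) = b z x \<oplus> b z y"
  using bilinear assms by (simp_all add: bilinear_form_def)

lemma form_smult [simp]:
  assumes "a \<in> carrier K" "x \<in> carrier V" "y \<in> carrier V"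
  shows "b (a \<odot>\<^bsub>V\<^esub> x) y = a \<otimes> b x y" "b x (a \<odot>\<^bsub>V\<^esub> y) = a \<otimes> b x y"
  using bilinear assms by (simp_all add: bilinear_form_def)

lemma form_zero [simp]:
  assumes "x \<in> carrier V"
  shows "b x \<zero>\<^bsub>V\<^esub> = \<zero>"
  using form_smult(2)[of \<zero> x "\<zero>\<^bsub>V\<^esub>"] assms by (simp add: smult_l_null)

text \<open>Interpreting the locale at the swapped form yields each statement on
  \<open>rperp\<close> for \<open>lperp\<close> as well.\<close>

lemma flip: "bilinear_space K V (\<lambda>x y. b y x)"
  using bilinear finite_dim by unfold_locales (auto simp: bilinear_form_def)

lemma orth_subspace:
  assumes "A \<subseteq> carrier V"
  shows "subspace K (rperp A) V"
proof (intro subspace.intro submodule.intro vectorspace_axioms module_axioms)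
  have c: "a \<in> carrier V" if "a \<in> A" for a using assms that by auto
  show "rperp A \<subseteq> carrier V" by (auto simp: orth_def)
  show "\<zero>\<^bsub>V\<^esub> \<in> rperp A" using c by (simp add: orth_def)
  show "v \<oplus>\<^bsub>V\<^esub> w \<in> rperp A" if "v \<in> rperp A" "w \<in> rperp A" for v w
    using that c by (simp add: orth_def)
  show "r \<odot>\<^bsub>V\<^esub> v \<in> rperp A" if "r \<in> carrier K" "v \<in> rperp A" for r v
    using that c by (simp add: orth_def)
qed

text \<open>This is the Galois connection between the two complements; \<open>orth_span\<close> and
  the easy half of \<open>orth_flip_orth\<close> follow from it.\<close>

lemma subset_orth_flip_iff:
  assumes "A \<subseteq> carrier V" "B \<subseteq> carrier V"
  shows "A \<subseteq> lperp B \<longleftrightarrow> B \<subseteq> rperp A"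
  using assms by (auto simp: orth_def)

lemma orth_span:
  assumes A: "A \<subseteq> carrier V"
  shows "rperp (span A) = rperp A"
proof
  interpret l: bilinear_space K V "\<lambda>x y. b y x" by (rule flip)
  show "rperp (span A) \<subseteq> rperp A"
    using in_own_span[OF A] by (auto simp: orth_def)
  have c: "rperp A \<subseteq> carrier V" by (auto simp: orth_def)
  have "span A \<subseteq> lperp (rperp A)"
    using A c
    by (intro span_is_subset is_module l.orth_subspace) (auto simp: subset_orth_flip_iff)
  then show "rperp A \<subseteq> rperp (span A)"
    using subset_orth_flip_iff[OF span_is_subset2[OF A] c] by simp
qed

text \<open>One more linear condition lowers the dimension by at most one: if \<open>b x\<close>
  does not vanish at some \<open>y\<close> in \<open>rperp A\<close>, then \<open>y\<close> and the
  kernel of \<open>b x\<close> on \<open>rperp A\<close> together span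
  \<open>rperp A\<close>.\<close>

lemma dim_orth_insert:
  assumes A: "A \<subseteq> carrier V" and x: "x \<in> carrier V"
  shows "dim_over K V (rperp A) \<le> dim_over K V (rperp (insert x A)) + 1"
proof -
  let ?X = "rperp (insert x A)"
  have X: "subspace K ?X V" using assms by (intro orth_subspace) auto
  have R: "subspace K (rperp A) V" using A by (rule orth_subspace)
  show ?thesis
  proof (cases "\<exists>y\<in>rperp A. b x y \<noteq> \<zero>")
    case False
    then have "rperp A \<subseteq> ?X" by (auto simp: orth_def)
    then show ?thesis using dim_subspace_mono[OF finite_dim R X] by simp
  next
    case True
    then obtain y where y: "y \<in> rperp A" "b x y \<noteq> \<zero>" by blast
    have yV: "y \<in> carrier V" using y by (simp add: orth_def)
    have unit: "b x y \<in> Units K" using y x yV by (simp add: field_Units)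
    let ?Y = "span {y}"
    have Y: "subspace K ?Y V" using yV by (intro span_is_subspace) auto
    have "rperp A \<subseteq> ?X <+>\<^bsub>V\<^esub> ?Y"
    proof
      fix z assume z: "z \<in> rperp A"
      have zV: "z \<in> carrier V" using z by (simp add: orth_def)
      \<comment> \<open>The coefficient is chosen so that \<open>b x\<close> vanishes at
        \<open>z\<close> minus \<open>c\<close> times \<open>y\<close>.\<close>
      define c where "c = b x z \<otimes> inv (b x y)"
      have c: "c \<in> carrier K" using unit x zV by (simp add: c_def)
      let ?z = "z \<oplus>\<^bsub>V\<^esub> (\<ominus> c) \<odot>\<^bsub>V\<^esub> y"
      have "b x ?z = b x z \<oplus> (\<ominus> c) \<otimes> b x y" using c x zV yV by simp
      also have "c \<otimes> b x y = b x z"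
        unfolding c_def using unit x zV yV by (simp add: m_assoc)
      then have "b x z \<oplus> (\<ominus> c) \<otimes> b x y = \<zero>"
        using c x yV zV by (simp add: l_minus R.r_neg)
      finally have "b x ?z = \<zero>" .
      moreover have "b a ?z = \<zero>" if "a \<in> A" for a
      proof -
        have "a \<in> carrier V" "b a z = \<zero>" "b a y = \<zero>"
          using that y(1) z A by (auto simp: orth_def)
        then show ?thesis using c zV yV by simp
      qed
      ultimately have "?z \<in> ?X" using c zV yV by (auto simp: orth_def)
      moreover have "c \<odot>\<^bsub>V\<^esub> y \<in> ?Y"
        using c span_self[OF yV] submodule.smult_closed[OF is_module[OF Y]] by blast
      moreover have "z = ?z \<oplus>\<^bsub>V\<^esub> c \<odot>\<^bsub>V\<^esub> y"
        using c zV yV by (simp add: M.a_assoc smult_l_minus M.l_neg)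
      ultimately show "z \<in> ?X <+>\<^bsub>V\<^esub> ?Y" unfolding set_add_def' by blast
    qed
    then have "dim_over K V (rperp A) \<le> dim_over K V (?X <+>\<^bsub>V\<^esub> ?Y)"
      by (rule dim_subspace_mono[OF finite_dim R subspace_set_add[OF X Y]])
    also have "\<dots> \<le> dim_over K V ?X + dim_over K V ?Y"
      using dim_set_add[OF finite_dim Y X] dim_quot_image[OF finite_dim Y X] by simp
    also have "\<dots> \<le> dim_over K V ?X + 1"
      using dim_span_le[of "{y}"] yV by simp
    finally show ?thesis .
  qed
qed

lemma dim_orth_Un:
  assumes "finite B" "A \<subseteq> carrier V" "B \<subseteq> carrier V"
  shows "dim_over K V (rperp A) \<le> dim_over K V (rperp (A \<union> B)) + card B"
  using assms
proof (induction B rule: finite_induct)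
  case (insert x B)
  then show ?case using dim_orth_insert[of "A \<union> B" x] by simp
qed simp

end

locale nondegenerate_space = bilinear_space +
  assumes nondegenerate: "nondegenerate_form K V b"
begin

lemma flip_nondegenerate: "nondegenerate_space K V (\<lambda>x y. b y x)"
  using flip nondegenerate
  by (auto simp: nondegenerate_space_def nondegenerate_space_axioms_def nondegenerate_form_def)

text \<open>With nested bases \<open>C\<close> of \<open>A\<close> and \<open>D\<close> of the
  space, imposing the conditions from \<open>C\<close> on the whole space costs at most
  \<open>card C\<close> dimensions. Imposing those from \<open>D - C\<close> on
  \<open>rperp C\<close> leaves only zero, by nondegeneracy. The two bounds meet.\<close>

lemma dim_orth:
  assumes A: "subspace K A V"
  shows "dim_over K V (rperp A) + dim_over K V A = dim"
proof -
  have AV: "A \<subseteq> carrier V" using submodule.subset[OF is_module[OF A]] .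
  obtain C D where D: "finite D" "C \<subseteq> D" "D \<subseteq> carrier V" "lin_indpt D" "span C = A"
    "span D = carrier V" "card C = dim_over K V A" "card D = dim_over K V (carrier V)"
    by (rule subspace_basis_extension[OF finite_dim A carrier_subspace AV])
  have CV: "C \<subseteq> carrier V" and fin: "finite C" using D by (auto intro: finite_subset)
  have RA: "rperp A = rperp C" using orth_span[OF CV] D(5) by simp
  have "rperp D = {\<zero>\<^bsub>V\<^esub>}"
    using orth_span[OF D(3)] D(6) nondegenerate by (auto simp: orth_def nondegenerate_form_def)
  moreover have "C \<union> (D - C) = D" using D(2) by auto
  ultimately have "dim_over K V (rperp C) \<le> card (D - C)"
    using dim_orth_Un[of "D - C" C] D(1,3) CV dim_zero_subspace by auto
  then have "dim_over K V (rperp C) + card C \<le> card D"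
    using card_Diff_subset[OF fin D(2)] card_mono[OF D(1,2)] by simp
  moreover have "rperp {} = carrier V" by (auto simp: orth_def)
  then have "dim_over K V (carrier V) \<le> dim_over K V (rperp C) + card C"
    using dim_orth_Un[OF fin _ CV, of "{}"] by simp
  ultimately show ?thesis using RA D(7,8) by simp
qed

text \<open>The inclusion of \<open>A\<close> is formal, and \<open>dim_orth\<close> for the form
  and for the swapped form shows that the dimensions agree.\<close>

lemma orth_flip_orth:
  assumes A: "subspace K A V"
  shows "lperp (rperp A) = A"
proof -
  interpret l: nondegenerate_space K V "\<lambda>x y. b y x" by (rule flip_nondegenerate)
  have AV: "A \<subseteq> carrier V" using submodule.subset[OF is_module[OF A]] .
  have c: "rperp A \<subseteq> carrier V" by (auto simp: orth_def)
  have R: "subspace K (rperp A) V" by (rule orth_subspace[OF AV])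
  have "A = lperp (rperp A)"
  proof (rule subspace_eqI[OF finite_dim A])
    show "subspace K (lperp (rperp A)) V" by (rule l.orth_subspace[OF c])
    show "A \<subseteq> lperp (rperp A)" using subset_orth_flip_iff[OF AV c] by simp
    show "dim_over K V (lperp (rperp A)) \<le> dim_over K V A"
      using dim_orth[OF A] l.dim_orth[OF R] by simp
  qed
  then show ?thesis ..
qed

lemma orth_set_add:
  assumes A: "subspace K A V" and B: "subspace K B V"
  shows "rperp (A <+>\<^bsub>V\<^esub> B) = rperp A \<inter> rperp B"
proof
  have AV: "A \<subseteq> carrier V" using submodule.subset[OF is_module[OF A]] .
  have BV: "B \<subseteq> carrier V" using submodule.subset[OF is_module[OF B]] .
  show "rperp (A <+>\<^bsub>V\<^esub> B) \<subseteq> rperp A \<inter> rperp B"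
    using subset_set_add[OF A B] by (auto simp: orth_def)
  show "rperp A \<inter> rperp B \<subseteq> rperp (A <+>\<^bsub>V\<^esub> B)"
    using AV BV by (auto simp: orth_def set_add_def' subset_iff)
qed

text \<open>This dualizes \<open>orth_set_add\<close>: the left complement of the sum on the right
  is \<open>A \<inter> B\<close>, and a further right complement recovers the sum.\<close>

lemma orth_Int:
  assumes A: "subspace K A V" and B: "subspace K B V"
  shows "rperp (A \<inter> B) = rperp A <+>\<^bsub>V\<^esub> rperp B"
proof -
  interpret l: nondegenerate_space K V "\<lambda>x y. b y x" by (rule flip_nondegenerate)
  have AV: "A \<subseteq> carrier V" using submodule.subset[OF is_module[OF A]] .
  have BV: "B \<subseteq> carrier V" using submodule.subset[OF is_module[OF B]] .
  note R = orth_subspace[OF AV] orth_subspace[OF BV]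
  have "lperp (rperp A <+>\<^bsub>V\<^esub> rperp B) = A \<inter> B"
    unfolding l.orth_set_add[OF R] orth_flip_orth[OF A] orth_flip_orth[OF B] ..
  then show ?thesis using l.orth_flip_orth[OF subspace_set_add[OF R]] by simp
qed

end

section \<open>Subspaces defined over a subfield\<close>

lemma (in vectorspace) dim_span_lin_indpt:
  assumes "finite A" "A \<subseteq> carrier V" "lin_indpt A"
  shows "dim_over K V (span A) = card A"
proof -
  have sub: "subspace K (span A) V" by (rule span_is_subspace[OF assms(2)])
  interpret A: vectorspace K "vs (span A)" using sub by (rule subspace_is_vs)
  note own = in_own_span[OF assms(2)]
  have "A.basis A"
    unfolding A.basis_def
    using span_li_not_depend[OF own is_module[OF sub]] own assms(3) by simp
  then show ?thesis by (rule A.dim_basis[OF assms(1)])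
qed

text \<open>Serves the passage to the subfield: a finite set of vectors is finite-dimensional over
  any field of scalars, by \<open>fin_dim_finite_carrier\<close>.\<close>

lemma (in vectorspace) finite_carrier:
  assumes "finite (carrier K)" "fin_dim"
  shows "finite (carrier V)"
proof -
  obtain A where A: "finite A" "basis A" using finite_basis_exists[OF assms(2)] by blast
  have AV: "A \<subseteq> carrier V" using A(2) by (simp add: basis_def)
  have "carrier V \<subseteq> (\<lambda>a. lincomb a A) ` (A \<rightarrow>\<^sub>E carrier K)"
  proof
    fix v assume "v \<in> carrier V"
    then have "\<exists>!a. a \<in> A \<rightarrow>\<^sub>E carrier K \<and> lincomb a A = v"
      using basis_criterion[OF A(1) AV] A(2) by blast
    then show "v \<in> (\<lambda>a. lincomb a A) ` (A \<rightarrow>\<^sub>E carrier K)" by blast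
  qed
  moreover have "finite (A \<rightarrow>\<^sub>E carrier K)" using A(1) assms(1) by (intro finite_PiE) auto
  ultimately show ?thesis by (rule finite_surj[rotated])
qed

lemma (in vectorspace) fin_dim_finite_carrier:
  assumes "finite (carrier V)"
  shows "fin_dim"
  unfolding fin_dim_def
  using assms in_own_span[of "carrier V"] span_is_subset2[of "carrier V"]
  by (intro exI[of _ "carrier V"]) auto

lemma (in vectorspace) subspace_vs_iff:
  assumes W: "subspace K W V"
  shows "subspace K S (vs W) \<longleftrightarrow> subspace K S V \<and> S \<subseteq> W"
proof -
  interpret W: vectorspace K "vs W" using W by (rule subspace_is_vs)
  have WV: "W \<subseteq> carrier V" using submodule.subset[OF is_module[OF W]] .
  show ?thesis
    using WV W.vectorspace_axioms W.module_axioms vectorspace_axioms module_axioms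
    by (auto simp: VectorSpace.subspace_def LinearCombinations.submodule_def)
qed

text \<open>The equality of the two dimensions makes every \<open>F\<close>-basis of
  \<open>W\<close> a \<open>K\<close>-basis of \<open>V\<close>, so that \<open>V\<close> is the
  scalar extension of \<open>W\<close>.\<close>

locale field_form = vectorspace K V
  for K :: "('a, 'k) ring_scheme" (structure) and V :: "('a, 'v, 'm) module_scheme" +
  fixes F :: "'a set" and W :: "'v set"
  assumes finite_dim: "fin_dim"
    and subfield: "subfield F K"
    and finite_dim_F: "vectorspace.fin_dim (K\<lparr>carrier := F\<rparr>) V"
    and W_subspace: "VectorSpace.subspace (K\<lparr>carrier := F\<rparr>) W V"
    and dim_W: "dim_over (K\<lparr>carrier := F\<rparr>) V W = dim"
    and span_W: "span W = carrier V"
begin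

abbreviation "KF \<equiv> K\<lparr>carrier := F\<rparr>"

sublocale F: vectorspace KF V
  by (rule vectorspace_subfield[OF vectorspace_axioms subfield])

lemma F_subset: "F \<subseteq> carrier K"
  using subfield by (simp add: subfieldE(3))

lemma W_carrier: "W \<subseteq> carrier V"
  using submodule.subset[OF F.is_module[OF W_subspace]] .

lemma subspace_restrict_scalars:
  assumes "subspace K A V"
  shows "subspace KF A V"
proof -
  interpret A: submodule K A V using assms by auto
  show ?thesis
    by (intro subspace.intro submodule.intro F.vectorspace_axioms F.module_axioms)
       (use A.subset F_subset in auto)
qed

lemma span_F_subset:
  assumes "A \<subseteq> carrier V"
  shows "F.span A \<subseteq> span A"
  by (rule F.span_is_subset[OF in_own_span[OF assms]])
     (intro F.is_module subspace_restrict_scalars span_is_subspace assms)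

text \<open>An \<open>F\<close>-basis \<open>D\<close> of \<open>W\<close> extending a basis of
  \<open>S\<close> generates \<open>V\<close> over \<open>K\<close>, as \<open>W\<close> does, and
  has only \<open>dim\<close> elements; hence it is independent over \<open>K\<close> too.\<close>

lemma W_basis:
  assumes S: "subspace KF S V" and SW: "S \<subseteq> W"
  obtains C D where "finite D" "C \<subseteq> D" "D \<subseteq> W" "F.lin_indpt D" "lin_indpt D"
    "F.span C = S" "span C = span S" "span D = carrier V" "card C = dim_over KF V S"
proof -
  obtain C D where D: "finite D" "C \<subseteq> D" "D \<subseteq> W" "F.lin_indpt D" "F.span C = S" "F.span D = W"
    "card C = dim_over KF V S" "card D = dim_over KF V W"
    by (rule F.subspace_basis_extension[OF finite_dim_F S W_subspace SW])
  have DV: "D \<subseteq> carrier V" and CV: "C \<subseteq> carrier V" using D W_carrier by auto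
  have CS: "C \<subseteq> S" using F.in_own_span[OF CV] D(5) by simp
  have spanS: "span C = span S"
  proof
    show "span C \<subseteq> span S" by (rule span_is_monotone[OF CS])
    show "span S \<subseteq> span C"
      using span_F_subset[OF CV] D(5) CV
      by (intro span_is_subset is_module span_is_subspace) auto
  qed
  have "span W \<subseteq> span D"
    using span_F_subset[OF DV] D(6) DV
    by (intro span_is_subset is_module span_is_subspace) auto
  then have genD: "span D = carrier V" using span_W span_is_subset2[OF DV] by auto
  have "basis D"
    using dim_W D(8) by (intro dim_gen_is_basis D(1) DV genD) simp
  then have "lin_indpt D" by (simp add: basis_def)
  then show ?thesis using that[of D C] D spanS genD by simp
qed

lemma dim_span:
  assumes S: "subspace KF S V" and SW: "S \<subseteq> W"
  shows "dim_over K V (span S) = dim_over KF V S"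
proof -
  obtain C D where D: "finite D" "C \<subseteq> D" "D \<subseteq> W" "F.lin_indpt D" "lin_indpt D"
    "F.span C = S" "span C = span S" "span D = carrier V" "card C = dim_over KF V S"
    by (rule W_basis[OF assms])
  have "finite C" "C \<subseteq> carrier V" using D W_carrier by (auto intro: finite_subset)
  then show ?thesis
    using dim_span_lin_indpt[of C] subset_li_is_li[OF D(5,2)] D(7,9) by simp
qed

end

locale field_form_bilinear = field_form K V F W
  for K :: "('a, 'k) ring_scheme" (structure) and V :: "('a, 'v, 'm) module_scheme"
    and F :: "'a set" and W :: "'v set" +
  fixes b :: "'v \<Rightarrow> 'v \<Rightarrow> 'a"
  assumes bilinear: "bilinear_form K V b"
    and bilinear_W: "bilinear_form (K\<lparr>carrier := F\<rparr>) (V\<lparr>carrier := W\<rparr>) b"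
    and nondegenerate_W: "nondegenerate_form (K\<lparr>carrier := F\<rparr>) (V\<lparr>carrier := W\<rparr>) b"
begin

lemma flip_field_form_bilinear: "field_form_bilinear K V F W (\<lambda>x y. b y x)"
  using bilinear bilinear_W nondegenerate_W
  by unfold_locales (auto simp: bilinear_form_def nondegenerate_form_def)

sublocale W: nondegenerate_space KF "V\<lparr>carrier := W\<rparr>" b
proof -
  interpret W: vectorspace KF "V\<lparr>carrier := W\<rparr>"
    by (rule F.subspace_is_vs[OF W_subspace])
  show "nondegenerate_space KF (V\<lparr>carrier := W\<rparr>) b"
    using F.subspace_fin_dim[OF finite_dim_F W_subspace] bilinear_W nondegenerate_W
    by unfold_locales
qed

text \<open>Take a minimal set of basis vectors of \<open>W\<close> whose span contains a radical vector. For each of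
  its elements some vector of \<open>W\<close> is orthogonal to all the others but not to it, which forces the
  corresponding coefficient to vanish.\<close>

lemma right_radical_zero:
  assumes v: "v \<in> carrier V" and rad: "\<And>x. x \<in> carrier V \<Longrightarrow> b x v = \<zero>"
  shows "v = \<zero>\<^bsub>V\<^esub>"
proof -
  interpret bilinear_space K V b
    using finite_dim bilinear by unfold_locales
  obtain C' D where D: "finite D" "C' \<subseteq> D" "D \<subseteq> W" "F.lin_indpt D" "lin_indpt D"
    "F.span C' = W" "span C' = span W" "span D = carrier V" "card C' = dim_over KF V W"
    by (rule W_basis[OF W_subspace order_refl])
  obtain C where C: "C \<subseteq> D" "minimal C (\<lambda>X. v \<in> span X)"
    using minimal_exists[of D "\<lambda>X. v \<in> span X"] D(1,8) v by auto
  have vC: "v \<in> span C" using C(2) by (simp add: minimal_def)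
  have "C = {}"
  proof (rule ccontr)
    assume "C \<noteq> {}"
    then obtain w where w: "w \<in> C" by auto
    define E where "E = C - {w}"
    have EC: "C = E \<union> {w}" and EW: "E \<subseteq> W" and wW: "w \<in> W" and wE: "w \<notin> E"
      using w C(1) D(3) by (auto simp: E_def)
    have EV: "E \<subseteq> carrier V" and wV: "w \<in> carrier V" using EW wW W_carrier by auto
    have li: "F.lin_indpt (E \<union> {w})"
      using F.subset_li_is_li[OF D(4) C(1)] EC by simp
    have "w \<notin> F.span E"
      using F.lin_dep_iff_in_span[OF EV _ wV wE] li F.subset_li_is_li[OF li, of E] by auto
    moreover have "subspace KF (F.span E) (V\<lparr>carrier := W\<rparr>)"
      using F.subspace_vs_iff[OF W_subspace] F.span_is_subspace[OF EV]
        F.span_is_subset[OF EW F.is_module[OF W_subspace]] by simp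
    \<comment> \<open>Inside \<open>W\<close> a subspace is its own double complement. Since
      \<open>w\<close> lies outside this one, some \<open>u\<close> orthogonal to \<open>E\<close>
      is not orthogonal to \<open>w\<close>.\<close>
    then have "W.rperp (W.lperp (F.span E)) = F.span E"
      using nondegenerate_space.orth_flip_orth[OF W.flip_nondegenerate] by simp
    ultimately obtain u where u: "u \<in> W.lperp (F.span E)" "b u w \<noteq> \<zero>"
      using wW by (auto simp: orth_def)
    have uV: "u \<in> carrier V" using u(1) W_carrier by (auto simp: orth_def)
    have "E \<subseteq> rperp {u}"
      using u(1) F.in_own_span[OF EV] EV by (auto simp: orth_def)
    then have orthE: "span E \<subseteq> rperp {u}"
      using uV by (intro span_is_subset is_module orth_subspace) auto
    have "v \<in> subspace_sum (span E) (span {w})"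
      using vC span_union_is_sum[OF EV, of "{w}"] wV EC by simp
    then obtain h y where h: "h \<in> span E" and y: "y \<in> span {w}" and vhy: "v = h \<oplus>\<^bsub>V\<^esub> y"
      by (auto simp: submodule_sum_def)
    obtain c where c: "c \<in> carrier K" "y = c \<odot>\<^bsub>V\<^esub> w"
      using y finite_span[of "{w}"] wV by (auto simp: lincomb_def)
    have hV: "h \<in> carrier V" using h EV by simp
    have "b u h = \<zero>" using h orthE by (auto simp: orth_def)
    then have "c \<otimes> b u w = \<zero>"
      using rad[OF uV] c uV hV wV by (simp add: vhy)
    then have "c = \<zero>" using u(2) c(1) uV wV by (simp add: integral_iff)
    then have "v = h" using vhy c hV wV by (simp add: smult_l_null)
    \<comment> \<open>Now \<open>v\<close> already lies in the span of \<open>E\<close>, against the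
      minimality of \<open>C\<close>.\<close>
    then have "E = C" using C(2) h EC by (auto simp: minimal_def)
    then show False using wE w by simp
  qed
  then show ?thesis using vC by (simp add: span_empty)
qed

text \<open>The left radical is the right radical of the swapped form, so both vanish. The results
  on complements thus hold in \<open>V\<close> over \<open>K\<close> as well as in \<open>W\<close>
  over \<open>F\<close>.\<close>

sublocale nondegenerate_space K V b
proof -
  interpret l: field_form_bilinear K V F W "\<lambda>x y. b y x" by (rule flip_field_form_bilinear)
  show "nondegenerate_space K V b"
    using finite_dim bilinear right_radical_zero l.right_radical_zero
    by unfold_locales (auto simp: nondegenerate_form_def)
qed

lemma orth_Int_W_subspace:
  assumes "A \<subseteq> carrier V"
  shows "subspace KF (rperp A \<inter> W) V"
  by (intro F.subspace_Int subspace_restrict_scalars orth_subspace assms W_subspace)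

lemma dim_orth_Int_W:
  assumes S: "subspace KF S V" and SW: "S \<subseteq> W"
  shows "dim_over KF V (rperp S \<inter> W) + dim_over KF V S = dim"
proof -
  have "W.rperp S = rperp S \<inter> W" using SW W_carrier by (auto simp: orth_def)
  moreover have "subspace KF S (V\<lparr>carrier := W\<rparr>)"
    using F.subspace_vs_iff[OF W_subspace] assms by simp
  ultimately show ?thesis using W.dim_orth[of S] dim_W by simp
qed

text \<open>One inclusion holds because orthogonality to \<open>S\<close> is orthogonality to its
  span, and both sides have dimension \<open>dim\<close> minus the \<open>F\<close>-dimension of
  \<open>S\<close>. Complements thus commute with scalar extension.\<close>

lemma orth_span_eq_span_orth:
  assumes S: "subspace KF S V" and SW: "S \<subseteq> W"
  shows "span (rperp S \<inter> W) = rperp (span S)"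
proof -
  have SV: "S \<subseteq> carrier V" using SW W_carrier by auto
  let ?R = "rperp S \<inter> W"
  have R: "subspace KF ?R V" by (rule orth_Int_W_subspace[OF SV])
  have RV: "?R \<subseteq> carrier V" using W_carrier by auto
  show ?thesis
  proof (rule subspace_eqI[OF finite_dim])
    show "subspace K (span ?R) V" by (rule span_is_subspace[OF RV])
    show *: "subspace K (rperp (span S)) V" by (rule orth_subspace[OF span_is_subset2[OF SV]])
    show "span ?R \<subseteq> rperp (span S)"
      using orth_span[OF SV] by (intro span_is_subset is_module[OF *]) auto
    show "dim_over K V (rperp (span S)) \<le> dim_over K V (span ?R)"
      using dim_orth[OF span_is_subspace[OF SV]] dim_span[OF S SW] dim_span[OF R]
        dim_orth_Int_W[OF S SW] by simp
  qed
qed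

end

section \<open>Weights, defects and duals\<close>

lemma (in vectorspace) quot_preimage_subspace:
  assumes N: "subspace K N V" and T: "subspace K T (quot_space V N)"
  shows "subspace K {v \<in> carrier V. N +>\<^bsub>V\<^esub> v \<in> T} V"
proof -
  interpret S: submodule K N V using N by auto
  interpret N: abelian_subgroup N V by (rule submodule_abelian_subgroup[OF is_module[OF N]])
  interpret Q: vectorspace K "quot_space V N" using N by (rule vectorspace_quot_space)
  interpret T: submodule K T "quot_space V N" using T by auto
  note smult = quot_space_smult_coset[OF is_module[OF N]]
  show ?thesis
  proof (intro subspace.intro submodule.intro vectorspace_axioms module_axioms)
    show "\<zero>\<^bsub>V\<^esub> \<in> {v \<in> carrier V. N +>\<^bsub>V\<^esub> v \<in> T}"
      using T.zero_closed M.a_coset_add_zero[OF S.subset] by simp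
    show "v \<oplus>\<^bsub>V\<^esub> w \<in> {v \<in> carrier V. N +>\<^bsub>V\<^esub> v \<in> T}"
      if "v \<in> {v \<in> carrier V. N +>\<^bsub>V\<^esub> v \<in> T}" "w \<in> {v \<in> carrier V. N +>\<^bsub>V\<^esub> v \<in> T}" for v w
      using that T.m_closed[of "N +>\<^bsub>V\<^esub> v" "N +>\<^bsub>V\<^esub> w"] by (simp add: N.a_rcos_sum)
    show "c \<odot>\<^bsub>V\<^esub> v \<in> {v \<in> carrier V. N +>\<^bsub>V\<^esub> v \<in> T}"
      if "c \<in> carrier K" "v \<in> {v \<in> carrier V. N +>\<^bsub>V\<^esub> v \<in> T}" for c v
      using that T.smult_closed[of c "N +>\<^bsub>V\<^esub> v"] smult[of c v] by simp
  qed auto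
qed

lemma (in vectorspace) quot_space_fin_dim:
  assumes fd: "fin_dim" and N: "subspace K N V"
  shows "vectorspace.fin_dim K (quot_space V N)"
proof -
  interpret f: linear_map K "vs (carrier V)" "quot_space V N" "\<lambda>v. N +>\<^bsub>V\<^esub> v"
    by (rule quot_linear_map[OF N carrier_subspace])
  show ?thesis
    by (rule f.surj_fin_dim[OF subspace_fin_dim[OF fd carrier_subspace]])
       (auto simp: A_RCOSETS_def')
qed

lemma (in vectorspace) quot_image_mono:
  "A \<subseteq> B \<Longrightarrow> quot_image V N A \<subseteq> quot_image V N B"
  by (auto simp: quot_image_def set_add_def')

section \<open>Weights and defects through preimages in \<open>W\<close>\<close>

context field_form
begin

abbreviation pullback :: "'v set \<Rightarrow> 'v set set \<Rightarrow> 'v set" where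
  "pullback N T \<equiv> {w \<in> W. N +>\<^bsub>V\<^esub> w \<in> T}"

lemma pullback_subspace:
  assumes "subspace K N V" "subspace K T (quot_space V N)"
  shows "subspace KF (pullback N T) V"
proof -
  have "pullback N T = W \<inter> {v \<in> carrier V. N +>\<^bsub>V\<^esub> v \<in> T}" using W_carrier by auto
  then show ?thesis
    using F.subspace_Int[OF W_subspace subspace_restrict_scalars[OF quot_preimage_subspace[OF assms]]]
    by simp
qed

text \<open>The image of \<open>pullback N T\<close> is the part of \<open>T\<close> inside the
  image of \<open>W\<close>, and the projection is injective on it since \<open>N\<close> meets
  \<open>W\<close> trivially.\<close>

lemma weight_eq_dim_pullback:
  assumes N: "subspace K N V" and NW: "N \<inter> W = {\<zero>\<^bsub>V\<^esub>}" and T: "subspace K T (quot_space V N)"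
  shows "weight K F (quot_space V N) (quot_image V N W) T = dim_over KF V (pullback N T)"
proof -
  let ?S = "pullback N T"
  have S: "subspace KF ?S V" by (rule pullback_subspace[OF N T])
  have SV: "?S \<subseteq> carrier V" using W_carrier by auto
  have "quot_image V N W \<inter> T = quot_image V N ?S"
    using quot_image_eq_image[OF N W_carrier] quot_image_eq_image[OF N SV] by auto
  moreover have "?S \<inter> N = {\<zero>\<^bsub>V\<^esub>}"
    using NW submodule.zero_closed[OF F.is_module[OF S]] by auto
  ultimately show ?thesis
    using F.dim_quot_image[OF finite_dim_F subspace_restrict_scalars[OF N] S] F.dim_zero_subspace
    by (simp add: weight_def)
qed

lemma quot_image_span_pullback_subset:
  assumes N: "subspace K N V" and T: "subspace K T (quot_space V N)"
  shows "quot_image V N (span (pullback N T)) \<subseteq> T"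
proof -
  have SV: "pullback N T \<subseteq> carrier V" using W_carrier by auto
  have "span (pullback N T) \<subseteq> {v \<in> carrier V. N +>\<^bsub>V\<^esub> v \<in> T}"
    by (rule span_is_subset[OF _ is_module[OF quot_preimage_subspace[OF N T]]])
       (use W_carrier in auto)
  then show ?thesis using quot_image_eq_image[OF N span_is_subset2[OF SV]] by auto
qed

text \<open>The generating cosets of \<open>T\<close> have representatives in
  \<open>pullback N T\<close>, so the image of its span contains them.\<close>

lemma quot_image_span_pullback_eq:
  assumes N: "subspace K N V" and T: "subspace K T (quot_space V N)"
    and span: "LinearCombinations.module.span K (quot_space V N) (T \<inter> quot_image V N W) = T"
  shows "quot_image V N (span (pullback N T)) = T"
proof
  interpret Q: vectorspace K "quot_space V N" using N by (rule vectorspace_quot_space)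
  let ?S = "pullback N T"
  have SV: "?S \<subseteq> carrier V" using W_carrier by auto
  show "quot_image V N (span ?S) \<subseteq> T" by (rule quot_image_span_pullback_subset[OF N T])
  have "T \<inter> quot_image V N W \<subseteq> quot_image V N (span ?S)"
    using in_own_span[OF SV] quot_image_eq_image[OF N W_carrier]
      quot_image_eq_image[OF N span_is_subset2[OF SV]] by auto
  then have "Q.span (T \<inter> quot_image V N W) \<subseteq> quot_image V N (span ?S)"
    by (intro Q.span_is_subset Q.is_module quot_image_subspace[OF N] span_is_subspace SV)
  then show "T \<subseteq> quot_image V N (span ?S)" using span by simp
qed

lemma dim_quot_image_span:
  assumes N: "subspace K N V" and S: "subspace KF S V" and SW: "S \<subseteq> W"
  shows "dim_over K (quot_space V N) (quot_image V N (span S)) + dim_over K V (span S \<inter> N) =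
    dim_over KF V S"
  using dim_quot_image[OF finite_dim N span_is_subspace, of S] dim_span[OF S SW] SW W_carrier
  by auto

text \<open>The span of the preimage may cover only part of \<open>T\<close>, whence an inequality.
  Minimality quantifies over all subspaces, also those not generated by their points in the image of
  \<open>W\<close>, and this bound covers them.\<close>

lemma defect_le:
  assumes N: "subspace K N V" and NW: "N \<inter> W = {\<zero>\<^bsub>V\<^esub>}" and T: "subspace K T (quot_space V N)"
  shows "defect K F (quot_space V N) (quot_image V N W) T
    \<le> int (dim_over K V (span (pullback N T) \<inter> N))"
proof -
  interpret Q: vectorspace K "quot_space V N" using N by (rule vectorspace_quot_space)
  have SV: "pullback N T \<subseteq> carrier V" using W_carrier by auto
  have "dim_over K (quot_space V N) (quot_image V N (span (pullback N T)))
      \<le> dim_over K (quot_space V N) T"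
    by (intro Q.dim_subspace_mono quot_space_fin_dim[OF finite_dim N] quot_image_subspace[OF N]
        span_is_subspace SV T quot_image_span_pullback_subset[OF N T])
  then show ?thesis
    using dim_quot_image_span[OF N pullback_subspace[OF N T]]
    by (simp add: defect_def weight_eq_dim_pullback[OF N NW T])
qed

text \<open>By rank-nullity the dimension of \<open>T\<close> falls short of the weight by exactly
  the part of the span that lies in \<open>N\<close>.\<close>

lemma defect_eq:
  assumes N: "subspace K N V" and NW: "N \<inter> W = {\<zero>\<^bsub>V\<^esub>}" and T: "subspace K T (quot_space V N)"
    and eq: "quot_image V N (span (pullback N T)) = T"
  shows "defect K F (quot_space V N) (quot_image V N W) T
    = int (dim_over K V (span (pullback N T) \<inter> N))"
  using dim_quot_image_span[OF N pullback_subspace[OF N T]] eq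
  by (simp add: defect_def weight_eq_dim_pullback[OF N NW T])

lemma subset_pullback_quot_image:
  assumes N: "subspace K N V" and SW: "S \<subseteq> W"
  shows "S \<subseteq> pullback N (quot_image V N (span S))"
proof -
  have SV: "S \<subseteq> carrier V" using SW W_carrier by auto
  show ?thesis
    using in_own_span[OF SV] quot_image_eq_image[OF N span_is_subset2[OF SV]] SW by auto
qed

end

section \<open>Duality of minimal subspaces\<close>

context field_form_bilinear
begin

lemma orth_flip_orth_Int_W:
  assumes S: "subspace KF S V" and SW: "S \<subseteq> W"
  shows "lperp (rperp S \<inter> W) \<inter> W = S"
proof -
  have SWs: "subspace KF S (V\<lparr>carrier := W\<rparr>)"
    using F.subspace_vs_iff[OF W_subspace] assms by simp
  have "W.rperp S = rperp S \<inter> W" using W_carrier by (auto simp: orth_def)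
  moreover have "W.lperp (rperp S \<inter> W) = lperp (rperp S \<inter> W) \<inter> W"
    using W_carrier by (auto simp: orth_def)
  ultimately show ?thesis using W.orth_flip_orth[OF SWs] by simp
qed

text \<open>Minimality of \<open>T\<close> enters here: if the preimage of the dual exceeded
  \<open>?S'\<close>, some proper subspace of \<open>T\<close> would have at least the same
  defect.\<close>

lemma pullback_dual_eq:
  assumes N: "subspace K N V" and NW: "N \<inter> W = {\<zero>\<^bsub>V\<^esub>}" and T: "subspace K T (quot_space V N)"
    and eq: "quot_image V N (span (pullback N T)) = T"
    and min: "minimal_wrt_defect K F (quot_space V N) (quot_image V N W) T"
  shows "pullback (rperp N) (quot_image V (rperp N) (rperp (span (pullback N T))))
    = rperp (pullback N T) \<inter> W"
    (is "?R = ?S'")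
proof -
  interpret l: field_form_bilinear K V F W "\<lambda>x y. b y x" by (rule flip_field_form_bilinear)
  define S where "S = pullback N T"
  define S' where "S' = rperp S \<inter> W"
  define R where "R = ?R"
  have S: "subspace KF S V" unfolding S_def by (rule pullback_subspace[OF N T])
  have SW: "S \<subseteq> W" by (auto simp: S_def)
  have SV: "S \<subseteq> carrier V" using SW W_carrier by auto
  have NV: "N \<subseteq> carrier V" using submodule.subset[OF is_module[OF N]] .
  have spS: "subspace K (span S) V" by (rule span_is_subspace[OF SV])
  have spSN: "subspace K (span S \<inter> N) V" by (rule subspace_Int[OF spS N])
  have spSNV: "span S \<inter> N \<subseteq> carrier V" using NV by auto
  have rN: "subspace K (rperp N) V" by (rule orth_subspace[OF NV])
  have rS: "subspace K (rperp (span S)) V" by (rule orth_subspace[OF span_is_subset2[OF SV]])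
  have rSV: "rperp (span S) \<subseteq> carrier V" by (auto simp: orth_def)
  \<comment> \<open>A vector of \<open>W\<close> lies in \<open>R\<close> iff it lies in the sum of
    \<open>rperp (span S)\<close> and \<open>rperp N\<close>, which \<open>orth_Int\<close>
    rewrites.\<close>
  have R_eq: "R = rperp (span S \<inter> N) \<inter> W"
    unfolding R_def S_def[symmetric] orth_Int[OF spS N]
    using coset_mem_quot_image_iff[OF rN rSV] W_carrier by auto
  have R: "subspace KF R V" unfolding R_eq by (rule orth_Int_W_subspace[OF spSNV])
  have RW: "R \<subseteq> W" and RV: "R \<subseteq> carrier V" using R_eq W_carrier by auto
  have S': "subspace KF S' V" unfolding S'_def by (rule orth_Int_W_subspace[OF SV])
  have S'R: "S' \<subseteq> R"
    unfolding S'_def R_eq orth_span[OF SV, symmetric] by (auto simp: orth_def)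
  \<comment> \<open>\<open>S0\<close> corresponds to \<open>R\<close> as \<open>S\<close> does to
    \<open>S'\<close>, so \<open>R = S'\<close> reduces to \<open>S0\<close> having the dimension of
    \<open>S\<close>.\<close>
  define S0 where "S0 = lperp R \<inter> W"
  have S0: "subspace KF S0 V" unfolding S0_def by (rule l.orth_Int_W_subspace[OF RV])
  have S0W: "S0 \<subseteq> W" by (simp add: S0_def)
  have S0V: "S0 \<subseteq> carrier V" using S0W W_carrier by auto
  have "lperp R \<subseteq> lperp S'" using S'R by (auto simp: orth_def)
  then have S0S: "S0 \<subseteq> S"
    using orth_flip_orth_Int_W[OF S SW] unfolding S0_def S'_def by blast
  have dimS0: "dim_over KF V S0 + dim_over KF V R = dim"
    unfolding S0_def by (rule l.dim_orth_Int_W[OF R RW])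
  have dimS': "dim_over KF V S' + dim_over KF V S = dim"
    unfolding S'_def by (rule dim_orth_Int_W[OF S SW])
  \<comment> \<open>The span of \<open>S0\<close> is all of \<open>lperp R\<close>, so shrinking
    \<open>S\<close> to \<open>S0\<close> loses nothing of the intersection with
    \<open>N\<close>.\<close>
  have "span S \<inter> N \<subseteq> lperp R"
    using subset_orth_flip_iff[OF spSNV RV] R_eq by simp
  then have "span S \<inter> N \<subseteq> span S0"
    unfolding S0_def l.orth_span_eq_span_orth[OF R RW] l.orth_span[OF RV] .
  then have int_eq: "span S0 \<inter> N = span S \<inter> N"
    using span_is_monotone[OF S0S] by auto
  have "dim_over KF V S \<le> dim_over KF V S0"
  proof (rule ccontr)
    assume less: "\<not> dim_over KF V S \<le> dim_over KF V S0"
    let ?Q = "quot_space V N" and ?T0 = "quot_image V N (span S0)"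
    have T0: "subspace K ?T0 ?Q" by (rule quot_image_subspace[OF N span_is_subspace[OF S0V]])
    have "?T0 \<subseteq> T"
      using quot_image_mono[OF span_is_monotone[OF S0S]] eq unfolding S_def[symmetric] by blast
    moreover have dT0: "dim_over K ?Q ?T0 + dim_over K V (span S \<inter> N) = dim_over KF V S0"
      using dim_quot_image_span[OF N S0 S0W] int_eq by simp
    moreover have dT: "dim_over K ?Q T + dim_over K V (span S \<inter> N) = dim_over KF V S"
      using dim_quot_image_span[OF N S SW] eq unfolding S_def[symmetric] by simp
    ultimately have "?T0 \<subset> T" using less by auto
    then have "defect K F ?Q (quot_image V N W) ?T0 < defect K F ?Q (quot_image V N W) T"
      using min T0 unfolding minimal_wrt_defect_def by blast
    \<comment> \<open>The preimage of \<open>?T0\<close> may exceed \<open>S0\<close>, which only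
      raises the defect. So \<open>?T0\<close> has defect at least the dimension of
      \<open>span S \<inter> N\<close>, which is the defect of \<open>T\<close>.\<close>
    moreover have "dim_over KF V S0 \<le> dim_over KF V (pullback N ?T0)"
      by (intro F.dim_subspace_mono finite_dim_F S0 pullback_subspace[OF N T0]
          subset_pullback_quot_image[OF N S0W])
    ultimately show False
      using dT dT0
      by (simp add: defect_def weight_eq_dim_pullback[OF N NW T] weight_eq_dim_pullback[OF N NW T0]
          S_def)
  qed
  then have "S' = R"
    using dimS0 dimS' by (intro F.subspace_eqI[OF finite_dim_F S' R S'R]) simp
  then show ?thesis by (simp add: R_def S'_def S_def)
qed

text \<open>Once \<open>pullback_dual_eq\<close> identifies the preimage of \<open>Td\<close> as
  \<open>S'\<close>, the claims are counts of dimensions. Weight and defect are stated additively to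
  avoid truncated subtraction.\<close>

theorem delsarte_dual:
  assumes N: "subspace K N V" and NW: "N \<inter> W = {\<zero>\<^bsub>V\<^esub>}" and N'W: "rperp N \<inter> W = {\<zero>\<^bsub>V\<^esub>}"
    and T: "subspace K T (quot_space V N)"
    and span: "LinearCombinations.module.span K (quot_space V N) (T \<inter> quot_image V N W) = T"
    and min: "minimal_wrt_defect K F (quot_space V N) (quot_image V N W) T"
    and refl: "\<And>x y. x \<in> W \<Longrightarrow> y \<in> W \<Longrightarrow> b x y = \<zero> \<Longrightarrow> b y x = \<zero>"
  defines "N' \<equiv> rperp N"
  defines "Td \<equiv> dual_subspace K V b W N N' T"
  shows "weight K F (quot_space V N') (quot_image V N' W) Td
      + weight K F (quot_space V N) (quot_image V N W) T = dim" (is ?weight)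
    and "defect K F (quot_space V N') (quot_image V N' W) Td
      + int (dim_over K (quot_space V N) T) + int (dim_over K V N) = int dim" (is ?defect)
    and "dual_subspace K V b W N' N Td = T" (is ?bidual)
    and "minimal_wrt_defect K F (quot_space V N') (quot_image V N' W) Td" (is ?minimal)
proof -
  interpret l: field_form_bilinear K V F W "\<lambda>x y. b y x" by (rule flip_field_form_bilinear)
  define S where "S = pullback N T"
  define S' where "S' = rperp S \<inter> W"
  have eq: "quot_image V N (span S) = T"
    unfolding S_def by (rule quot_image_span_pullback_eq[OF N T span])
  have S: "subspace KF S V" unfolding S_def by (rule pullback_subspace[OF N T])
  have SW: "S \<subseteq> W" by (auto simp: S_def)
  have SV: "S \<subseteq> carrier V" using SW W_carrier by auto
  have spS: "subspace K (span S) V" by (rule span_is_subspace[OF SV])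
  have NV: "N \<subseteq> carrier V" using submodule.subset[OF is_module[OF N]] .
  have N': "subspace K N' V" unfolding N'_def by (rule orth_subspace[OF NV])
  have N'W: "N' \<inter> W = {\<zero>\<^bsub>V\<^esub>}" using N'W by (simp add: N'_def)
  have S': "subspace KF S' V" unfolding S'_def by (rule orth_Int_W_subspace[OF SV])
  have S'W: "S' \<subseteq> W" by (simp add: S'_def)
  have S'V: "S' \<subseteq> carrier V" using S'W W_carrier by auto
  have spS': "span S' = rperp (span S)"
    unfolding S'_def by (rule orth_span_eq_span_orth[OF S SW])
  have Td: "Td = quot_image V N' (span S')"
    by (simp add: Td_def dual_subspace_def spS' S_def)
  have pb: "pullback N' Td = S'"
    using pullback_dual_eq[OF N NW T eq[unfolded S_def] min]
    unfolding Td unfolding spS' unfolding N'_def S'_def S_def .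
  have Tds: "subspace K Td (quot_space V N')"
    unfolding Td by (rule quot_image_subspace[OF N' span_is_subspace[OF S'V]])
  have dimS': "dim_over KF V S' + dim_over KF V S = dim"
    unfolding S'_def by (rule dim_orth_Int_W[OF S SW])
  have defTd: "defect K F (quot_space V N') (quot_image V N' W) Td
      = int (dim_over K V (span S' \<inter> N'))"
    using defect_eq[OF N' N'W Tds] Td pb by simp
  have lS': "lperp (span S') = span S" unfolding spS' by (rule orth_flip_orth[OF spS])
  have lN': "lperp N' = N" unfolding N'_def by (rule orth_flip_orth[OF N])
  show ?weight
    using dimS' pb
    by (simp add: weight_eq_dim_pullback[OF N NW T] weight_eq_dim_pullback[OF N' N'W Tds] S_def)
  \<comment> \<open>The defect of \<open>Td\<close> is thus the codimension of the sum of
    \<open>span S\<close> and \<open>N\<close>, whose dimension is that of \<open>T\<close> plus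
    that of \<open>N\<close>.\<close>
  have "span S' \<inter> N' = rperp (span S <+>\<^bsub>V\<^esub> N)"
    unfolding spS' N'_def by (rule orth_set_add[OF spS N, symmetric])
  then show ?defect
    using dim_orth[OF subspace_set_add[OF spS N]] dim_set_add[OF finite_dim N spS] eq defTd by simp
  show ?bidual
  proof -
    \<comment> \<open>\<open>dual_subspace\<close> takes a right complement twice, whereas the
      double complement law pairs right with left; reflexivity on \<open>W\<close> bridges the
      two.\<close>
    have "rperp S' \<inter> W = lperp S' \<inter> W"
      using refl S'W by (auto simp: orth_def)
    also have "\<dots> = S" unfolding S'_def by (rule orth_flip_orth_Int_W[OF S SW])
    finally have "rperp (span S') = span S"
      using orth_span_eq_span_orth[OF S' S'W] by simp
    then show ?thesis by (simp add: dual_subspace_def pb eq)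
  qed
  show ?minimal
    unfolding minimal_wrt_defect_def
  proof (intro allI impI, rule ccontr)
    fix X
    assume "subspace K X (quot_space V N') \<and> X \<subset> Td"
    then have X: "subspace K X (quot_space V N')" and XTd: "X \<subseteq> Td" "X \<noteq> Td" by auto
    assume ge: "\<not> defect K F (quot_space V N') (quot_image V N' W) X
      < defect K F (quot_space V N') (quot_image V N' W) Td"
    define R where "R = pullback N' X"
    have R: "subspace KF R V" unfolding R_def by (rule pullback_subspace[OF N' X])
    have RW: "R \<subseteq> W" by (auto simp: R_def)
    have RV: "R \<subseteq> carrier V" using RW W_carrier by auto
    have RS': "R \<subseteq> S'" using XTd(1) pb by (auto simp: R_def)
    have spR: "subspace K (span R) V" by (rule span_is_subspace[OF RV])
    \<comment> \<open>A competitor \<open>X\<close> of no smaller defect forces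
      \<open>span R\<close> to contain all of \<open>span S' \<inter> N'\<close>. Left complements
      then turn this equality of intersections into one of sums with \<open>N\<close>.\<close>
    have "dim_over K V (span S' \<inter> N') \<le> dim_over K V (span R \<inter> N')"
      using ge defect_le[OF N' N'W X] defTd by (simp add: R_def)
    then have "span R \<inter> N' = span S' \<inter> N'"
      using span_is_monotone[OF RS']
      by (intro subspace_eqI[OF finite_dim] subspace_Int spR N' span_is_subspace S'V) auto
    then have "lperp (span R) <+>\<^bsub>V\<^esub> N = span S <+>\<^bsub>V\<^esub> N"
      using l.orth_Int[OF spR N'] l.orth_Int[OF span_is_subspace[OF S'V] N'] lS' lN' by simp
    moreover have "lperp (span R) \<subseteq> lperp (span R) <+>\<^bsub>V\<^esub> N"
      by (rule subset_set_add(1)[OF l.orth_subspace[OF span_is_subset2[OF RV]] N])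
    ultimately have "lperp R \<subseteq> span S <+>\<^bsub>V\<^esub> N" using l.orth_span[OF RV] by simp
    \<comment> \<open>A vector of \<open>W\<close> in the sum of \<open>span S\<close> and
      \<open>N\<close> projects into \<open>T\<close>, hence lies in the preimage
      \<open>S\<close>.\<close>
    then have "lperp R \<inter> W \<subseteq> S"
      using coset_mem_quot_image_iff[OF N span_is_subset2[OF SV]] W_carrier eq
      by (auto simp: S_def)
    then have "dim_over KF V (lperp R \<inter> W) \<le> dim_over KF V S"
      by (rule F.dim_subspace_mono[OF finite_dim_F l.orth_Int_W_subspace[OF RV] S])
    \<comment> \<open>Complementation in \<open>W\<close> reverses the bound on dimensions, so
      \<open>R\<close> is at least as large as \<open>S'\<close>. Then \<open>X\<close> contains the
      image of \<open>span S'\<close>, which is \<open>Td\<close>.\<close>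
    then have "R = S'"
      using l.dim_orth_Int_W[OF R RW] dimS'
      by (intro F.subspace_eqI[OF finite_dim_F R S' RS']) simp
    then show False
      using quot_image_span_pullback_subset[OF N' X] XTd Td by (simp add: R_def)
  qed
qed

end

section \<open>Specialization to finite fields\<close>

theorem theorem1p26:
  fixes K :: "('a, 'k) ring_scheme" and F :: "'a set"
    and V :: "('a, 'v, 'm) module_scheme" and W \<Gamma> \<Gamma>p :: "'v set"
    and \<sigma>' \<sigma> :: "'v \<Rightarrow> 'v \<Rightarrow> 'a"
    and q m k n :: nat
    and Q Qd :: "('a, 'v set) module" and U Ud T Td :: "'v set set"
  assumes "primepow q" and "0 < m" and "1 \<le> k" and "k < n"
    and "field K" and "subfield F K" and "card F = q" and "card (carrier K) = q ^ m"
    and "vectorspace K V" and "vectorspace.fin_dim K V" and "vectorspace.dim K V = n"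
    and "VectorSpace.subspace (K\<lparr>carrier := F\<rparr>) W V" and "dim_over (K\<lparr>carrier := F\<rparr>) V W = n"
    and "LinearCombinations.module.span K V W = carrier V"
    and "bilinear_form (K\<lparr>carrier := F\<rparr>) (V\<lparr>carrier := W\<rparr>) \<sigma>'"
    and "reflexive_form (K\<lparr>carrier := F\<rparr>) (V\<lparr>carrier := W\<rparr>) \<sigma>'"
    and "nondegenerate_form (K\<lparr>carrier := F\<rparr>) (V\<lparr>carrier := W\<rparr>) \<sigma>'"
    and "bilinear_form K V \<sigma>" and "\<forall>x\<in>W. \<forall>y\<in>W. \<sigma> x y = \<sigma>' x y"
    and "VectorSpace.subspace K \<Gamma> V" and "dim_over K V \<Gamma> = n - k" and "\<Gamma> \<inter> W = {\<zero>\<^bsub>V\<^esub>}"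
    and "\<Gamma>p = orth K V \<sigma> \<Gamma>" and "\<Gamma>p \<inter> W = {\<zero>\<^bsub>V\<^esub>}"
    and "Q = quot_space V \<Gamma>" and "U = quot_image V \<Gamma> W"
    and "Qd = quot_space V \<Gamma>p" and "Ud = quot_image V \<Gamma>p W"
    and "VectorSpace.subspace K T Q" and "LinearCombinations.module.span K Q (T \<inter> U) = T"
    and "defect K F Q U T > 0"
    and "minimal_wrt_defect K F Q U T"
    and "Td = dual_subspace K V \<sigma> W \<Gamma> \<Gamma>p T"
  shows "int (weight K F Qd Ud Td) = int n - int (weight K F Q U T)
    \<and> defect K F Qd Ud Td = int k - int (dim_over K Q T)
    \<and> dual_subspace K V \<sigma> W \<Gamma>p \<Gamma> Td = T
    \<and> minimal_wrt_defect K F Qd Ud Td"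
proof -
  let ?KF = "K\<lparr>carrier := F\<rparr>"
  \<comment> \<open>A positive cardinality excludes the infinite case, in which \<open>card\<close>
    would be 0.\<close>
  have fin_K: "finite (carrier K)"
    using assms(1,8) primepow_gt_0_nat[of q] card_ge_0_finite[of "carrier K"] by simp
  interpret V: vectorspace K V by fact
  interpret VF: vectorspace ?KF V by (rule vectorspace_subfield[OF assms(9,6)])
  have fd: "VF.fin_dim"
    by (rule VF.fin_dim_finite_carrier[OF V.finite_carrier[OF fin_K assms(10)]])
  have bW: "bilinear_form ?KF (V\<lparr>carrier := W\<rparr>) \<sigma>"
  proof -
    \<comment> \<open>Closure of \<open>W\<close> under the operations lets \<open>\<sigma>\<close>
      be replaced by \<open>\<sigma>'\<close> also at sums and multiples.\<close>
    have "x \<oplus>\<^bsub>V\<^esub> y \<in> W" if "x \<in> W" "y \<in> W" for x y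
      using that submodule.m_closed[OF VF.is_module[OF assms(12)]] by blast
    moreover have "a \<odot>\<^bsub>V\<^esub> x \<in> W" if "a \<in> F" "x \<in> W" for a x
      using that submodule.smult_closed[OF VF.is_module[OF assms(12)]] by simp
    ultimately show ?thesis using assms(15,19) unfolding bilinear_form_def by simp
  qed
  have nW: "nondegenerate_form ?KF (V\<lparr>carrier := W\<rparr>) \<sigma>"
    using assms(17,19) by (simp add: nondegenerate_form_def)
  have dW: "dim_over ?KF V W = V.dim" using assms(11,13) by simp
  interpret field_form_bilinear K V F W \<sigma>
    by (intro field_form_bilinear.intro field_form.intro field_form_axioms.intro
        field_form_bilinear_axioms.intro)
       (fact assms(9,10,6,12,14,18) fd dW bW nW)+
  have refl: "\<sigma> y x = \<zero>\<^bsub>K\<^esub>" if "x \<in> W" "y \<in> W" "\<sigma> x y = \<zero>\<^bsub>K\<^esub>" for x y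
    using assms(16,19) that by (simp add: reflexive_form_def)
  have N'W: "orth K V \<sigma> \<Gamma> \<inter> W = {\<zero>\<^bsub>V\<^esub>}" using assms(23,24) by simp
  note dual = delsarte_dual[OF assms(20,22) N'W assms(29)[unfolded assms(25)]
      assms(30)[unfolded assms(25,26)] assms(32)[unfolded assms(25,26)] refl,
      folded assms(23), folded assms(25-28,33)]
  have "int (weight K F Qd Ud Td) = int n - int (weight K F Q U T)"
    using dual(1) unfolding assms(11) by linarith
  \<comment> \<open>Since \<open>k < n\<close>, the natural-number difference \<open>n - k\<close>
    for the dimension of \<open>\<Gamma>\<close> is not truncated.\<close>
  moreover have "defect K F Qd Ud Td = int k - int (dim_over K Q T)"
    using dual(2) assms(4) unfolding assms(11,21) by linarith
  ultimately show ?thesis using dual(3,4) by (intro conjI)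
qed

end
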